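(* Let $R$ be a principal ideal domain. Given morphisms of differential graded algebras over $R$, $\eta:(A,d_A)\to(B,d_B)$ and $\psi:(TV,d)\to(B,d_B)$, such that (i) $(TV,d)$ is a minimal dga; (ii) $\eta$ is a surjective quasi-isomorphism; there exists a morphism of differential graded algebras $\varphi:(TV,d)\to(A,d_A)$ such that $\eta\circ\varphi=\psi$.
   Context: Differential graded algebras (dga's) are cohomologically graded with differential of degree $+1$; a quasi-isomorphism is a morphism inducing an isomorphism in (co)homology. $TV$ denotes the tensor algebra on a free graded $R$-module $V$. Here a minimal dga is a dga $(TV,d)$ arising as a free model: $V=\bigcup_k V(k)$ is the union of an increasing sequence of graded free submodules $0=V(0)\subset V(1)\subset V(2)\subset\cdots$, each $V(k)$ being the direct sum of $V(k-1)$ and a free module, with $d:V(k)\to T(V(k-1))$; and, moreover, $d:V\to T^{\ge2}V$ (decomposable differential) if $R$ is a field, while if $R$ is not a field, for each $i$ there is a non-invertible $r_i\in R$ such that the linear part of $d$ maps $V^i$ into $r_iV^{i+1}$. *)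

theory Defs
  imports "HOL-Algebra.Algebra"
begin

section \<open>Graded modules and graded algebras\<close>

text \<open>
  Gradings are internal and indexed by the integers: \<open>grade M n\<close> is the set of homogeneous elements
  of degree \<open>n\<close>, zero included. As for \<^const>\<open>module\<close>, the fields \<open>mult\<close> and \<open>one\<close> carry no meaning
  as long as only a graded module is concerned.
\<close>

record ('r, 'm) graded = "('r, 'm) module" +
  grade :: "int \<Rightarrow> 'm set"

locale graded_module = module R M
  for R (structure) and M :: "('r, 'm, 'x) graded_scheme" (structure) +
  assumes grade_submodule: "submodule (grade M n) R M"
    and grade_decomp: "x \<in> carrier M \<Longrightarrow>
      \<exists>!c. (\<forall>n. c n \<in> grade M n) \<and> finite {n. c n \<noteq> \<zero>\<^bsub>M\<^esub>} \<and>
           x = (\<Oplus>\<^bsub>M\<^esub>n\<in>{n. c n \<noteq> \<zero>\<^bsub>M\<^esub>}. c n)"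

text \<open>The library's \<^locale>\<open>algebra\<close> is commutative, hence the separate definition.\<close>

locale graded_algebra = graded_module R A + A?: ring A
  for R (structure) and A :: "('r, 'a, 'x) graded_scheme" (structure) +
  assumes smult_mult_left: "\<lbrakk>r \<in> carrier R; x \<in> carrier A; y \<in> carrier A\<rbrakk> \<Longrightarrow>
      (r \<odot>\<^bsub>A\<^esub> x) \<otimes>\<^bsub>A\<^esub> y = r \<odot>\<^bsub>A\<^esub> (x \<otimes>\<^bsub>A\<^esub> y)"
    and smult_mult_right: "\<lbrakk>r \<in> carrier R; x \<in> carrier A; y \<in> carrier A\<rbrakk> \<Longrightarrow>
      x \<otimes>\<^bsub>A\<^esub> (r \<odot>\<^bsub>A\<^esub> y) = r \<odot>\<^bsub>A\<^esub> (x \<otimes>\<^bsub>A\<^esub> y)"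
    and one_grade: "\<one>\<^bsub>A\<^esub> \<in> grade A 0"
    and mult_grade: "\<lbrakk>x \<in> grade A m; y \<in> grade A n\<rbrakk> \<Longrightarrow> x \<otimes>\<^bsub>A\<^esub> y \<in> grade A (m + n)"

definition graded_algebra_hom ::
    "('r, 'k) ring_scheme \<Rightarrow> ('r, 'a, 'x) graded_scheme \<Rightarrow> ('r, 'b, 'y) graded_scheme \<Rightarrow> ('a \<Rightarrow> 'b) set"
  where "graded_algebra_hom R A B =
    {f \<in> ring_hom A B.
       (\<forall>r\<in>carrier R. \<forall>x\<in>carrier A. f (r \<odot>\<^bsub>A\<^esub> x) = r \<odot>\<^bsub>B\<^esub> f x) \<and>
       (\<forall>n. f ` grade A n \<subseteq> grade B n)}"

definition restrict_graded :: "('r, 'm, 'x) graded_scheme \<Rightarrow> 'm set \<Rightarrow> ('r, 'm, 'x) graded_scheme"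
  where "restrict_graded M U = M\<lparr>carrier := U, grade := (\<lambda>n. grade M n \<inter> U)\<rparr>"

text \<open>Quotient by a two-sided ideal that is an \<open>R\<close>-submodule; the ring structure is that of \<^const>\<open>FactRing\<close>.\<close>

definition graded_quotient :: "('r, 'm, 'x) graded_scheme \<Rightarrow> 'm set \<Rightarrow> ('r, 'm set) graded"
  where "graded_quotient M I =
    \<lparr>carrier = carrier (M Quot I), monoid.mult = monoid.mult (M Quot I), monoid.one = monoid.one (M Quot I),
     ring.zero = ring.zero (M Quot I), ring.add = ring.add (M Quot I),
     smult = (\<lambda>r C. I <+>\<^bsub>M\<^esub> (\<lambda>x. r \<odot>\<^bsub>M\<^esub> x) ` C),
     grade = (\<lambda>n. (\<lambda>x. I +>\<^bsub>M\<^esub> x) ` grade M n)\<rparr>"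


section \<open>Free graded modules\<close>

definition finsupp :: "('r, 'k) ring_scheme \<Rightarrow> 'i set \<Rightarrow> ('i \<Rightarrow> 'r) set"
  where "finsupp R S =
    {c. (\<forall>x. c x \<in> carrier R) \<and> (\<forall>x. x \<notin> S \<longrightarrow> c x = \<zero>\<^bsub>R\<^esub>) \<and> finite {x. c x \<noteq> \<zero>\<^bsub>R\<^esub>}}"

definition lincomb :: "('r, 'k) ring_scheme \<Rightarrow> ('r, 'm, 'x) module_scheme \<Rightarrow> ('m \<Rightarrow> 'r) \<Rightarrow> 'm"
  where "lincomb R M c = (\<Oplus>\<^bsub>M\<^esub>x\<in>{x. c x \<noteq> \<zero>\<^bsub>R\<^esub>}. c x \<odot>\<^bsub>M\<^esub> x)"

definition module_basis :: "('r, 'k) ring_scheme \<Rightarrow> ('r, 'm, 'x) module_scheme \<Rightarrow> 'm set \<Rightarrow> bool"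
  where "module_basis R M S \<longleftrightarrow>
    S \<subseteq> carrier M \<and> bij_betw (lincomb R M) (finsupp R S) (carrier M)"

definition free_graded_module :: "('r, 'k) ring_scheme \<Rightarrow> ('r, 'm, 'x) graded_scheme \<Rightarrow> bool"
  where "free_graded_module R M \<longleftrightarrow>
    graded_module R M \<and> (\<exists>S. S \<subseteq> (\<Union>n. grade M n) \<and> module_basis R M S)"

definition free_graded_submodule :: "'m set \<Rightarrow> ('r, 'k) ring_scheme \<Rightarrow> ('r, 'm, 'x) graded_scheme \<Rightarrow> bool"
  where "free_graded_submodule U R M \<longleftrightarrow>
    submodule U R M \<and> free_graded_module R (restrict_graded M U)"


section \<open>The tensor algebra\<close>

text \<open>
  The tensor algebra of \<open>V\<close> is the free associative \<open>R\<close>-algebra on the set \<open>carrier V\<close>, divided by the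
  ideal that makes the inclusion of \<open>V\<close> linear. The word \<open>[v\<^sub>1, \<dots>, v\<^sub>k]\<close> represents the tensor
  \<open>v\<^sub>1 \<otimes> \<dots> \<otimes> v\<^sub>k\<close>.
\<close>

definition word :: "('r, 'k) ring_scheme \<Rightarrow> 'v list \<Rightarrow> 'v list \<Rightarrow> 'r"
  where "word R w = (\<lambda>u. if u = w then \<one>\<^bsub>R\<^esub> else \<zero>\<^bsub>R\<^esub>)"

definition word_degree :: "('r, 'v, 'x) graded_scheme \<Rightarrow> int \<Rightarrow> 'v list \<Rightarrow> bool"
  where "word_degree V n w \<longleftrightarrow>
    (\<exists>ns. list_all2 (\<lambda>v i. v \<in> grade V i) w ns \<and> sum_list ns = n)"

text \<open>
  The \<open>grade\<close> field is not a grading of the free algebra, whose letters may be inhomogeneous elements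
  of \<open>V\<close>; it only becomes one in the quotient.
\<close>

definition free_algebra ::
    "('r, 'k) ring_scheme \<Rightarrow> ('r, 'v, 'x) graded_scheme \<Rightarrow> ('r, 'v list \<Rightarrow> 'r) graded"
  where "free_algebra R V =
    \<lparr>carrier = finsupp R (lists (carrier V)),
     monoid.mult = (\<lambda>p q w. \<Oplus>\<^bsub>R\<^esub>k\<in>{..length w}. p (take k w) \<otimes>\<^bsub>R\<^esub> q (drop k w)),
     monoid.one = word R [],
     ring.zero = (\<lambda>w. \<zero>\<^bsub>R\<^esub>),
     ring.add = (\<lambda>p q w. p w \<oplus>\<^bsub>R\<^esub> q w),
     smult = (\<lambda>r p w. r \<otimes>\<^bsub>R\<^esub> p w),
     grade = (\<lambda>n. finsupp R {w \<in> lists (carrier V). word_degree V n w})\<rparr>"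

definition tensor_ideal ::
    "('r, 'k) ring_scheme \<Rightarrow> ('r, 'v, 'x) graded_scheme \<Rightarrow> ('v list \<Rightarrow> 'r) set"
  where "tensor_ideal R V = (let F = free_algebra R V in
    Idl\<^bsub>F\<^esub>
     ({word R [u \<oplus>\<^bsub>V\<^esub> v] \<ominus>\<^bsub>F\<^esub> (word R [u] \<oplus>\<^bsub>F\<^esub> word R [v]) | u v. u \<in> carrier V \<and> v \<in> carrier V} \<union>
      {word R [r \<odot>\<^bsub>V\<^esub> v] \<ominus>\<^bsub>F\<^esub> (r \<odot>\<^bsub>F\<^esub> word R [v]) | r v. r \<in> carrier R \<and> v \<in> carrier V}))"

definition tensor_algebra ::
    "('r, 'k) ring_scheme \<Rightarrow> ('r, 'v, 'x) graded_scheme \<Rightarrow> ('r, ('v list \<Rightarrow> 'r) set) graded"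
  where "tensor_algebra R V = graded_quotient (free_algebra R V) (tensor_ideal R V)"

definition tensor_class ::
    "('r, 'k) ring_scheme \<Rightarrow> ('r, 'v, 'x) graded_scheme \<Rightarrow> ('v list \<Rightarrow> 'r) \<Rightarrow> ('v list \<Rightarrow> 'r) set"
  where "tensor_class R V p = tensor_ideal R V +>\<^bsub>free_algebra R V\<^esub> p"

definition tensor_incl ::
    "('r, 'k) ring_scheme \<Rightarrow> ('r, 'v, 'x) graded_scheme \<Rightarrow> 'v \<Rightarrow> ('v list \<Rightarrow> 'r) set"
  where "tensor_incl R V v = tensor_class R V (word R [v])"

definition tensor_span ::
    "('r, 'k) ring_scheme \<Rightarrow> ('r, 'v, 'x) graded_scheme \<Rightarrow> ('v list \<Rightarrow> bool) \<Rightarrow> ('v list \<Rightarrow> 'r) set set"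
  where "tensor_span R V P = tensor_class R V ` finsupp R {w \<in> lists (carrier V). P w}"

text \<open>\<open>T U\<close> inside \<open>T V\<close>, for a submodule \<open>U\<close> of \<open>V\<close>.\<close>

definition tensor_sub ::
    "('r, 'k) ring_scheme \<Rightarrow> ('r, 'v, 'x) graded_scheme \<Rightarrow> 'v set \<Rightarrow> ('v list \<Rightarrow> 'r) set set"
  where "tensor_sub R V U = tensor_span R V (\<lambda>w. set w \<subseteq> U)"

definition tensor_ge ::
    "('r, 'k) ring_scheme \<Rightarrow> ('r, 'v, 'x) graded_scheme \<Rightarrow> nat \<Rightarrow> ('v list \<Rightarrow> 'r) set set"
  where "tensor_ge R V k = tensor_span R V (\<lambda>w. k \<le> length w)"

text \<open>Projection of \<open>T V = T\<^sup>0 V \<oplus> V \<oplus> T\<^sup>\<ge>\<^sup>2 V\<close> onto \<open>V\<close>.\<close>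

definition linear_part ::
    "('r, 'k) ring_scheme \<Rightarrow> ('r, 'v, 'x) graded_scheme \<Rightarrow> ('v list \<Rightarrow> 'r) set \<Rightarrow> 'v"
  where "linear_part R V t = (THE v. v \<in> carrier V \<and>
    (\<exists>c\<in>tensor_span R V (\<lambda>w. w = []). \<exists>z\<in>tensor_ge R V 2.
       t = c \<oplus>\<^bsub>tensor_algebra R V\<^esub> tensor_incl R V v \<oplus>\<^bsub>tensor_algebra R V\<^esub> z))"


section \<open>Differential graded algebras\<close>

definition neg_pow :: "('r, 'a, 'x) graded_scheme \<Rightarrow> int \<Rightarrow> 'a \<Rightarrow> 'a"
  where "neg_pow A n x = (if even n then x else \<ominus>\<^bsub>A\<^esub> x)"

locale dga = graded_algebra R A
  for R (structure) and A :: "('r, 'a, 'x) graded_scheme" (structure) +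
  fixes d :: "'a \<Rightarrow> 'a"
  assumes d_closed: "x \<in> carrier A \<Longrightarrow> d x \<in> carrier A"
    and d_add: "\<lbrakk>x \<in> carrier A; y \<in> carrier A\<rbrakk> \<Longrightarrow> d (x \<oplus>\<^bsub>A\<^esub> y) = d x \<oplus>\<^bsub>A\<^esub> d y"
    and d_smult: "\<lbrakk>r \<in> carrier R; x \<in> carrier A\<rbrakk> \<Longrightarrow> d (r \<odot>\<^bsub>A\<^esub> x) = r \<odot>\<^bsub>A\<^esub> d x"
    and d_grade: "x \<in> grade A n \<Longrightarrow> d x \<in> grade A (n + 1)"
    and d_d: "x \<in> carrier A \<Longrightarrow> d (d x) = \<zero>\<^bsub>A\<^esub>"
    and d_mult: "\<lbrakk>x \<in> grade A n; y \<in> carrier A\<rbrakk> \<Longrightarrow>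
      d (x \<otimes>\<^bsub>A\<^esub> y) = d x \<otimes>\<^bsub>A\<^esub> y \<oplus>\<^bsub>A\<^esub> neg_pow A n (x \<otimes>\<^bsub>A\<^esub> d y)"

definition dga_hom ::
    "('r, 'k) ring_scheme \<Rightarrow> ('r, 'a, 'x) graded_scheme \<Rightarrow> ('a \<Rightarrow> 'a) \<Rightarrow>
     ('r, 'b, 'y) graded_scheme \<Rightarrow> ('b \<Rightarrow> 'b) \<Rightarrow> ('a \<Rightarrow> 'b) set"
  where "dga_hom R A dA B dB =
    {f \<in> graded_algebra_hom R A B. \<forall>x\<in>carrier A. f (dA x) = dB (f x)}"

definition cocycles :: "('r, 'a, 'x) graded_scheme \<Rightarrow> ('a \<Rightarrow> 'a) \<Rightarrow> 'a set"
  where "cocycles A d = {x \<in> carrier A. d x = \<zero>\<^bsub>A\<^esub>}"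

definition coboundaries :: "('r, 'a, 'x) graded_scheme \<Rightarrow> ('a \<Rightarrow> 'a) \<Rightarrow> 'a set"
  where "coboundaries A d = d ` carrier A"

definition cohomology :: "('r, 'a, 'x) graded_scheme \<Rightarrow> ('a \<Rightarrow> 'a) \<Rightarrow> ('r, 'a set) graded"
  where "cohomology A d = graded_quotient (restrict_graded A (cocycles A d)) (coboundaries A d)"

text \<open>The class of a cocycle \<open>z\<close> goes to the class of \<open>f z\<close>.\<close>

definition cohomology_map ::
    "('r, 'b, 'y) graded_scheme \<Rightarrow> ('b \<Rightarrow> 'b) \<Rightarrow> ('a \<Rightarrow> 'b) \<Rightarrow> 'a set \<Rightarrow> 'b set"
  where "cohomology_map B dB f C = coboundaries B dB <+>\<^bsub>B\<^esub> f ` C"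

definition quasi_isomorphism ::
    "('r, 'k) ring_scheme \<Rightarrow> ('r, 'a, 'x) graded_scheme \<Rightarrow> ('a \<Rightarrow> 'a) \<Rightarrow>
     ('r, 'b, 'y) graded_scheme \<Rightarrow> ('b \<Rightarrow> 'b) \<Rightarrow> ('a \<Rightarrow> 'b) \<Rightarrow> bool"
  where "quasi_isomorphism R A dA B dB f \<longleftrightarrow>
    f \<in> dga_hom R A dA B dB \<and>
    cohomology_map B dB f \<in> graded_algebra_hom R (cohomology A dA) (cohomology B dB) \<and>
    bij_betw (cohomology_map B dB f) (carrier (cohomology A dA)) (carrier (cohomology B dB))"


section \<open>Minimal dga's\<close>

definition free_model_filtration ::
    "('r, 'k) ring_scheme \<Rightarrow> ('r, 'v, 'x) graded_scheme \<Rightarrow>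
     (('v list \<Rightarrow> 'r) set \<Rightarrow> ('v list \<Rightarrow> 'r) set) \<Rightarrow> (nat \<Rightarrow> 'v set) \<Rightarrow> bool"
  where "free_model_filtration R V d U \<longleftrightarrow>
    U 0 = {\<zero>\<^bsub>V\<^esub>} \<and> (\<Union>k. U k) = carrier V \<and>
    (\<forall>k. free_graded_submodule (U k) R V) \<and>
    (\<forall>k. \<exists>W. free_graded_submodule W R V \<and>
       U (Suc k) = U k <+>\<^bsub>V\<^esub> W \<and> U k \<inter> W = {\<zero>\<^bsub>V\<^esub>}) \<and>
    (\<forall>k. \<forall>v\<in>U (Suc k). d (tensor_incl R V v) \<in> tensor_sub R V (U k))"

definition minimal_differential ::
    "('r, 'k) ring_scheme \<Rightarrow> ('r, 'v, 'x) graded_scheme \<Rightarrow>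
     (('v list \<Rightarrow> 'r) set \<Rightarrow> ('v list \<Rightarrow> 'r) set) \<Rightarrow> bool"
  where "minimal_differential R V d \<longleftrightarrow>
    (if field R
     then \<forall>v\<in>carrier V. d (tensor_incl R V v) \<in> tensor_ge R V 2
     else \<forall>i. \<exists>r\<in>carrier R - Units R. \<forall>v\<in>grade V i.
            linear_part R V (d (tensor_incl R V v)) \<in> (\<lambda>u. r \<odot>\<^bsub>V\<^esub> u) ` grade V (i + 1))"

definition minimal_dga ::
    "('r, 'k) ring_scheme \<Rightarrow> ('r, 'v, 'x) graded_scheme \<Rightarrow>
     (('v list \<Rightarrow> 'r) set \<Rightarrow> ('v list \<Rightarrow> 'r) set) \<Rightarrow> bool"
  where "minimal_dga R V d \<longleftrightarrow>
    free_graded_module R V \<and> dga R (tensor_algebra R V) d \<and>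
    (\<exists>U. free_model_filtration R V d U) \<and> minimal_differential R V d"

end

theory Submission
  imports Defs
begin

text \<open>
  The free homogeneous complements in the filtration of \<open>V\<close> glue to one homogeneous basis
  \<open>S = \<Union>k. S k\<close> of \<open>V\<close> in which \<open>S k\<close> spans \<open>V(k)\<close>. A morphism \<open>T V \<rightarrow> A\<close> of graded algebras is
  given by its values on \<open>S\<close>, and it commutes with the differentials on \<open>T(V(k))\<close> as soon as it does
  on \<open>S k\<close>. If \<open>F\<close> lifts \<open>\<psi>\<close> and is compatible with \<open>d\<close> on \<open>T(V(k))\<close>, then for \<open>s \<in> S (k + 1)\<close> the
  element \<open>z = F (d s)\<close> is a cocycle with \<open>\<eta> z = d (\<psi> s)\<close>, and surjectivity together with
  bijectivity on cohomology yields \<open>a\<close> with \<open>\<eta> a = \<psi> s\<close> and \<open>d a = z\<close>, the next value of the lift.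
  Every stage is a globally defined linear map on \<open>V\<close> that lifts \<open>\<psi>\<close>; only the compatibility
  with \<open>d\<close> grows, so the extension to \<open>T V\<close> is available throughout.
\<close>

section \<open>Finitely supported coefficient families\<close>

text \<open>The element \<open>a\<close> comes from a diagram chase. Injectivity on cohomology gives
  \<open>z = d a'\<close>. Then the difference of \<open>\<psi> s\<close> and
  \<open>\<eta> a'\<close> is a cocycle, so surjectivity on cohomology writes it as the image of a
  cocycle plus a coboundary, and since \<eta> itself is onto, that coboundary is the image of a
  coboundary. A homogeneous component of the sum has the right degree. The obstacle is that new
  values on \<open>S (k + 1)\<close> change the extension to \<open>T V\<close> as a whole, and with
  it the elements \<open>F (d s)\<close> that they were chosen to match. The filtration removes it:
  \<open>d s\<close> lies in \<open>T(V(k))\<close>, where the extension sees only the values on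
  \<open>S k\<close>, and these are kept. The basis has to be homogeneous because the Leibniz rule
  carries a sign given by the degree of the left factor: commutation with \<open>d\<close> is
  checked letter by letter, on letters that have a degree.\<close>

definition lincomb_of ::
    "('r, 'k) ring_scheme \<Rightarrow> ('r, 'm, 'x) module_scheme \<Rightarrow> ('i \<Rightarrow> 'm) \<Rightarrow> ('i \<Rightarrow> 'r) \<Rightarrow> 'm"
  where "lincomb_of R M g c = (\<Oplus>\<^bsub>M\<^esub>i\<in>{i. c i \<noteq> \<zero>\<^bsub>R\<^esub>}. c i \<odot>\<^bsub>M\<^esub> g i)"

text \<open>The family \<open>g\<close> is what varies later: the identity for coordinates in a
  basis, \<open>word_prod A f\<close> for evaluating noncommutative polynomials, and arbitrary
  prescribed values for extending a map from a basis.\<close>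

lemma lincomb_eq_lincomb_of: "lincomb R M = lincomb_of R M (\<lambda>x. x)"
  by (simp add: fun_eq_iff lincomb_def lincomb_of_def)

definition single :: "('r, 'k) ring_scheme \<Rightarrow> 'i \<Rightarrow> 'i \<Rightarrow> 'r"
  where "single R i = (\<lambda>j. if j = i then \<one>\<^bsub>R\<^esub> else \<zero>\<^bsub>R\<^esub>)"

lemma word_eq_single: "word R w = single R w"
  by (simp add: word_def single_def)

lemma finsuppD:
  assumes "c \<in> finsupp R S"
  shows "c x \<in> carrier R" "x \<notin> S \<Longrightarrow> c x = \<zero>\<^bsub>R\<^esub>" "finite {x. c x \<noteq> \<zero>\<^bsub>R\<^esub>}"
  using assms by (auto simp: finsupp_def)

lemma finsupp_mono: "S \<subseteq> T \<Longrightarrow> finsupp R S \<subseteq> finsupp R T"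
  by (auto simp: finsupp_def)

context cring
begin

lemma finsupp_zero: "(\<lambda>_. \<zero>) \<in> finsupp R S"
  by (simp add: finsupp_def)

lemma finsupp_add:
  assumes "c \<in> finsupp R S" "c' \<in> finsupp R S"
  shows "(\<lambda>x. c x \<oplus> c' x) \<in> finsupp R S"
proof -
  have "finite {x. c x \<oplus> c' x \<noteq> \<zero>}"
    by (rule finite_subset[of _ "{x. c x \<noteq> \<zero>} \<union> {x. c' x \<noteq> \<zero>}"]) (use assms in \<open>auto simp: finsupp_def\<close>)
  then show ?thesis using assms by (auto simp: finsupp_def)
qed

lemma finsupp_smult:
  assumes "c \<in> finsupp R S" "r \<in> carrier R"
  shows "(\<lambda>x. r \<otimes> c x) \<in> finsupp R S"
proof -
  have "finite {x. r \<otimes> c x \<noteq> \<zero>}"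
    by (rule finite_subset[of _ "{x. c x \<noteq> \<zero>}"]) (use assms in \<open>auto simp: finsupp_def\<close>)
  then show ?thesis using assms by (auto simp: finsupp_def)
qed

lemma finsupp_single: "i \<in> S \<Longrightarrow> single R i \<in> finsupp R S"
  by (auto simp: finsupp_def single_def)

lemma finsupp_restrict:
  assumes "c \<in> finsupp R S"
  shows "(\<lambda>x. if x \<in> T then c x else \<zero>) \<in> finsupp R (S \<inter> T)"
proof -
  have "finite {x. (if x \<in> T then c x else \<zero>) \<noteq> \<zero>}"
    by (rule finite_subset[of _ "{x. c x \<noteq> \<zero>}"]) (use assms in \<open>auto simp: finsupp_def\<close>)
  then show ?thesis using assms by (auto simp: finsupp_def)
qed

text \<open>The step adds a multiple of a unit vector instead of inserting a fresh index, so that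
  linearity of whatever is evaluated at \<open>c\<close> is enough to prove it.\<close>

lemma finsupp_induct [consumes 1, case_names zero add]:
  assumes c: "c \<in> finsupp R S"
    and zero: "P (\<lambda>_. \<zero>)"
    and add: "\<And>c i r. \<lbrakk>c \<in> finsupp R S; i \<in> S; r \<in> carrier R; P c\<rbrakk> \<Longrightarrow> P (\<lambda>j. r \<otimes> single R i j \<oplus> c j)"
  shows "P c"
proof -
  have "finite {x. c x \<noteq> \<zero>}" using c by (rule finsuppD)
  moreover have "F = {x. c x \<noteq> \<zero>} \<Longrightarrow> c \<in> finsupp R S \<Longrightarrow> P c" if "finite F" for F c
    using that
  proof (induction F arbitrary: c rule: finite_induct)
    case empty
    then have "c = (\<lambda>_. \<zero>)" by (auto simp: fun_eq_iff)
    then show ?case using zero by simp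
  next
    case (insert i F)
    define c' where "c' = (\<lambda>j. if j = i then \<zero> else c j)"
    have supp: "{x. c' x \<noteq> \<zero>} = F" using insert.prems(1) insert.hyps by (auto simp: c'_def)
    have fs: "c' \<in> finsupp R S"
      using insert.prems(2) supp insert.hyps(1) by (auto simp: finsupp_def c'_def)
    have "c i \<noteq> \<zero>" using insert.prems(1) by auto
    then have "i \<in> S" using insert.prems(2) by (auto simp: finsupp_def)
    moreover have "c = (\<lambda>j. c i \<otimes> single R i j \<oplus> c' j)"
      using finsuppD(1)[OF insert.prems(2)] by (auto simp: fun_eq_iff c'_def single_def)
    moreover have "P c'" using insert.IH[OF supp[symmetric] fs] .
    ultimately show ?case using add[OF fs, of i "c i"] finsuppD(1)[OF insert.prems(2)] by simp
  qed
  ultimately show ?thesis using c by blast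
qed

end

section \<open>Linearity of linear combinations in their coefficients\<close>

context module
begin

text \<open>The index set in \<open>lincomb_of\<close> depends on \<open>c\<close>, so sums for
  different coefficients cannot be combined directly; a common finite index set \<open>J\<close>
  repairs this. The guard \<open>i \<in> S\<close> is there because \<open>g\<close> is controlled
  only on \<open>S\<close>.\<close>

lemma lincomb_of_superset:
  assumes "c \<in> finsupp R S" "g \<in> S \<rightarrow> carrier M" "finite J" "{i. c i \<noteq> \<zero>} \<subseteq> J"
  shows "lincomb_of R M g c = (\<Oplus>\<^bsub>M\<^esub>i\<in>J. if i \<in> S then c i \<odot>\<^bsub>M\<^esub> g i else \<zero>\<^bsub>M\<^esub>)"
  unfolding lincomb_of_def
proof (rule M.add.finprod_mono_neutral_cong_left)
  have "\<And>i. c i \<noteq> \<zero> \<Longrightarrow> i \<in> S" using assms(1) by (auto simp: finsupp_def)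
  then show "\<And>x. x \<in> {i. c i \<noteq> \<zero>} \<Longrightarrow> c x \<odot>\<^bsub>M\<^esub> g x = (if x \<in> S then c x \<odot>\<^bsub>M\<^esub> g x else \<zero>\<^bsub>M\<^esub>)" by auto
qed (use assms finsuppD[OF assms(1)] in \<open>auto simp: Pi_iff\<close>)

lemma lincomb_of_closed:
  assumes "c \<in> finsupp R S" "g \<in> S \<rightarrow> carrier M"
  shows "lincomb_of R M g c \<in> carrier M"
proof -
  have "\<And>i. c i \<noteq> \<zero> \<Longrightarrow> i \<in> S" using assms(1) by (auto simp: finsupp_def)
  then show ?thesis unfolding lincomb_of_def
    by (intro M.finsum_closed) (use assms finsuppD[OF assms(1)] in auto)
qed

lemma lincomb_of_zero: "lincomb_of R M g (\<lambda>_. \<zero>) = \<zero>\<^bsub>M\<^esub>"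
  by (simp add: lincomb_of_def)

lemma lincomb_of_single:
  assumes "g i \<in> carrier M"
  shows "lincomb_of R M g (single R i) = g i"
proof -
  have "lincomb_of R M g (single R i) = (\<Oplus>\<^bsub>M\<^esub>j\<in>{i}. if j \<in> {i} then single R i j \<odot>\<^bsub>M\<^esub> g j else \<zero>\<^bsub>M\<^esub>)"
    using assms by (intro lincomb_of_superset finsupp_single) (auto simp: single_def split: if_splits)
  also have "\<dots> = g i" using assms by (subst M.finsum_insert) (auto simp: single_def)
  finally show ?thesis .
qed

lemma lincomb_of_add:
  assumes c: "c \<in> finsupp R S" and c': "c' \<in> finsupp R S" and g: "g \<in> S \<rightarrow> carrier M"
  shows "lincomb_of R M g (\<lambda>i. c i \<oplus> c' i) = lincomb_of R M g c \<oplus>\<^bsub>M\<^esub> lincomb_of R M g c'"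
proof -
  define J where "J = {i. c i \<noteq> \<zero>} \<union> {i. c' i \<noteq> \<zero>}"
  have J: "finite J" "{i. c i \<noteq> \<zero>} \<subseteq> J" "{i. c' i \<noteq> \<zero>} \<subseteq> J" "{i. c i \<oplus> c' i \<noteq> \<zero>} \<subseteq> J"
    using c c' by (auto simp: J_def finsupp_def)
  note cl = finsuppD(1)[OF c] finsuppD(1)[OF c']
  show ?thesis
    unfolding lincomb_of_superset[OF finsupp_add[OF c c'] g J(1,4)]
      lincomb_of_superset[OF c g J(1,2)] lincomb_of_superset[OF c' g J(1,3)]
    by (subst M.finsum_addf[symmetric])
       (use cl g in \<open>auto intro!: M.add.finprod_cong' simp: smult_l_distr Pi_iff simp del: M.finsum_addf\<close>)
qed

lemma lincomb_of_smult:
  assumes c: "c \<in> finsupp R S" and r: "r \<in> carrier R" and g: "g \<in> S \<rightarrow> carrier M"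
  shows "lincomb_of R M g (\<lambda>i. r \<otimes> c i) = r \<odot>\<^bsub>M\<^esub> lincomb_of R M g c"
proof -
  define J where "J = {i. c i \<noteq> \<zero>}"
  have J: "finite J" "{i. c i \<noteq> \<zero>} \<subseteq> J" "{i. r \<otimes> c i \<noteq> \<zero>} \<subseteq> J"
    using c r by (auto simp: J_def finsupp_def)
  note cl = finsuppD(1)[OF c]
  show ?thesis
    unfolding lincomb_of_superset[OF finsupp_smult[OF c r] g J(1,3)]
      lincomb_of_superset[OF c g J(1,2)]
    by (subst finsum_smult_ldistr)
       (use cl g r in \<open>auto intro!: M.finsum_cong' simp: smult_assoc1 J Pi_iff\<close>)
qed

lemma lincomb_of_step:
  assumes "c \<in> finsupp R S" "i \<in> S" "r \<in> carrier R" "g \<in> S \<rightarrow> carrier M"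
  shows "lincomb_of R M g (\<lambda>j. r \<otimes> single R i j \<oplus> c j) = r \<odot>\<^bsub>M\<^esub> g i \<oplus>\<^bsub>M\<^esub> lincomb_of R M g c"
  using assms
  by (simp add: lincomb_of_add[OF finsupp_smult[OF finsupp_single]] lincomb_of_smult[OF finsupp_single]
      lincomb_of_single funcset_mem)

lemma lincomb_of_mem_submodule:
  assumes "c \<in> finsupp R S" "submodule N R M" "g \<in> S \<rightarrow> N"
  shows "lincomb_of R M g c \<in> N"
proof -
  note N = submoduleE[OF assms(2)]
  have g: "g \<in> S \<rightarrow> carrier M" using assms(3) N(1) by auto
  have z: "\<zero>\<^bsub>M\<^esub> \<in> N"
    using subgroup.one_closed[OF submodule.axioms(1)[OF assms(2)]] by simp
  show ?thesis using assms(1)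
    by (induction rule: finsupp_induct)
       (use assms(3) N g in \<open>simp_all add: lincomb_of_zero lincomb_of_step z Pi_iff\<close>)
qed

end

section \<open>The free algebra\<close>

text \<open>The multiplication of \<open>free_algebra\<close>, detached from the record: the Cauchy
  product over all cuts of a word. The sum is finite for any coefficient functions, so its laws can
  be proved without reference to supports.\<close>

definition conv ::
    "('r, 'k) ring_scheme \<Rightarrow> ('v list \<Rightarrow> 'r) \<Rightarrow> ('v list \<Rightarrow> 'r) \<Rightarrow> 'v list \<Rightarrow> 'r"
  where "conv R p q = (\<lambda>w. \<Oplus>\<^bsub>R\<^esub>k\<in>{..length w}. p (take k w) \<otimes>\<^bsub>R\<^esub> q (drop k w))"

lemma free_algebra_simps:
  "carrier (free_algebra R V) = finsupp R (lists (carrier V))"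
  "p \<otimes>\<^bsub>free_algebra R V\<^esub> q = conv R p q"
  "\<one>\<^bsub>free_algebra R V\<^esub> = word R []"
  "\<zero>\<^bsub>free_algebra R V\<^esub> = (\<lambda>w. \<zero>\<^bsub>R\<^esub>)"
  "p \<oplus>\<^bsub>free_algebra R V\<^esub> q = (\<lambda>w. p w \<oplus>\<^bsub>R\<^esub> q w)"
  "r \<odot>\<^bsub>free_algebra R V\<^esub> p = (\<lambda>w. r \<otimes>\<^bsub>R\<^esub> p w)"
  "grade (free_algebra R V) n = finsupp R {w \<in> lists (carrier V). word_degree V n w}"
  by (simp_all add: free_algebra_def conv_def)

section \<open>The convolution product and the ring axioms of the free algebra\<close>

context cring
begin

lemma conv_Nil:
  assumes "\<And>u. p u \<in> carrier R" "\<And>u. q u \<in> carrier R"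
  shows "conv R p q [] = p [] \<otimes> q []"
  using assms by (simp add: conv_def)

text \<open>The cut before the first letter is split off; every other cut leaves \<open>a\<close> in
  the left factor. This recursion turns laws of convolution into inductions on the word.\<close>

lemma conv_Cons:
  assumes "\<And>u. p u \<in> carrier R" "\<And>u. q u \<in> carrier R"
  shows "conv R p q (a # w) = p [] \<otimes> q (a # w) \<oplus> conv R (\<lambda>u. p (a # u)) q w"
  unfolding conv_def length_Cons using assms
  by (subst finsum_Suc2) (auto simp: a_comm Pi_iff finsum_closed simp del: finsum_Suc)

lemma conv_closed:
  assumes "\<And>u. p u \<in> carrier R" "\<And>u. q u \<in> carrier R"
  shows "conv R p q w \<in> carrier R"
  using assms by (auto simp: conv_def intro!: finsum_closed)

lemma conv_add_left:
  assumes "\<And>u. p u \<in> carrier R" "\<And>u. p' u \<in> carrier R" "\<And>u. q u \<in> carrier R"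
  shows "conv R (\<lambda>u. p u \<oplus> p' u) q w = conv R p q w \<oplus> conv R p' q w"
  unfolding conv_def using assms by (simp add: l_distr finsum_addf)

lemma conv_add_right:
  assumes "\<And>u. p u \<in> carrier R" "\<And>u. q u \<in> carrier R" "\<And>u. q' u \<in> carrier R"
  shows "conv R p (\<lambda>u. q u \<oplus> q' u) w = conv R p q w \<oplus> conv R p q' w"
  unfolding conv_def using assms by (simp add: r_distr finsum_addf)

lemma conv_smult_left:
  assumes "\<And>u. p u \<in> carrier R" "\<And>u. q u \<in> carrier R" "r \<in> carrier R"
  shows "conv R (\<lambda>u. r \<otimes> p u) q w = r \<otimes> conv R p q w"
  unfolding conv_def using assms by (simp add: finsum_rdistr m_assoc)

lemma conv_smult_right:
  assumes "\<And>u. p u \<in> carrier R" "\<And>u. q u \<in> carrier R" "r \<in> carrier R"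
  shows "conv R p (\<lambda>u. r \<otimes> q u) w = r \<otimes> conv R p q w"
  unfolding conv_def using assms by (simp add: finsum_rdistr m_lcomm)

lemma conv_zero_left: "(\<And>u. q u \<in> carrier R) \<Longrightarrow> conv R (\<lambda>u. \<zero>) q w = \<zero>"
  by (simp add: conv_def)

lemma conv_zero_right: "(\<And>u. p u \<in> carrier R) \<Longrightarrow> conv R p (\<lambda>u. \<zero>) w = \<zero>"
  by (simp add: conv_def)

text \<open>By \<open>conv_Cons\<close>, reading \<open>conv R p q\<close> after the letter
  \<open>a\<close> gives a multiple of a shift of \<open>q\<close> plus the convolution of a shift
  of \<open>p\<close> with \<open>q\<close>. Linearity in the left argument separates the two, and
  the induction hypothesis is applied to the shifted \<open>p\<close>, which is why the functions
  are generalised.\<close>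

lemma conv_assoc:
  assumes "\<And>u. p u \<in> carrier R" "\<And>u. q u \<in> carrier R" "\<And>u. s u \<in> carrier R"
  shows "conv R (conv R p q) s w = conv R p (conv R q s) w"
  using assms
proof (induction w arbitrary: p q s)
  case Nil
  then show ?case by (simp add: conv_Nil conv_closed m_assoc)
next
  case (Cons a w)
  note cl = Cons.prems
  have "conv R (conv R p q) s (a # w) =
      (p [] \<otimes> q []) \<otimes> s (a # w) \<oplus> conv R (\<lambda>u. p [] \<otimes> q (a # u) \<oplus> conv R (\<lambda>v. p (a # v)) q u) s w"
    using cl by (simp add: conv_Cons conv_Nil conv_closed)
  also have "conv R (\<lambda>u. p [] \<otimes> q (a # u) \<oplus> conv R (\<lambda>v. p (a # v)) q u) s w
      = p [] \<otimes> conv R (\<lambda>u. q (a # u)) s w \<oplus> conv R (\<lambda>v. p (a # v)) (conv R q s) w"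
    using cl by (simp add: conv_add_left conv_smult_left conv_closed Cons.IH[of "\<lambda>v. p (a # v)"])
  finally show ?case
    using cl by (simp add: conv_Cons conv_closed r_distr m_assoc a_assoc)
qed

lemma conv_finsupp:
  assumes p: "p \<in> finsupp R (lists Y)" and q: "q \<in> finsupp R (lists Y)"
  shows "conv R p q \<in> finsupp R (lists Y)"
proof -
  note P = finsuppD[OF p] and Q = finsuppD[OF q]
  \<comment> \<open>Concatenations of words from the two supports: outside \<open>Z\<close>, each
    cut has a vanishing factor.\<close>
  define Z where "Z = (\<lambda>(u, v). u @ v) ` ({u. p u \<noteq> \<zero>} \<times> {v. q v \<noteq> \<zero>})"
  have fin: "finite Z" using P(3) Q(3) by (simp add: Z_def)
  have sub: "w \<in> Z \<and> w \<in> lists Y" if "conv R p q w \<noteq> \<zero>" for w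
  proof -
    have "\<exists>k. p (take k w) \<otimes> q (drop k w) \<noteq> \<zero>"
    proof (rule ccontr)
      assume "\<not> ?thesis"
      then have "conv R p q w = \<zero>" unfolding conv_def by (intro add.finprod_one_eqI) auto
      with that show False by simp
    qed
    then obtain k where "p (take k w) \<otimes> q (drop k w) \<noteq> \<zero>" by blast
    then have k: "p (take k w) \<noteq> \<zero>" "q (drop k w) \<noteq> \<zero>" using P(1) Q(1) by auto
    then have "take k w \<in> lists Y" "drop k w \<in> lists Y" using P(2) Q(2) by blast+
    then have "take k w @ drop k w \<in> lists Y" by (simp only: append_in_lists_conv)
    moreover have "take k w @ drop k w \<in> Z" unfolding Z_def using k by (force simp del: append_take_drop_id)
    ultimately show ?thesis by simp
  qed
  have "finite {w. conv R p q w \<noteq> \<zero>}" by (rule finite_subset[OF _ fin]) (use sub in auto)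
  then show ?thesis unfolding finsupp_def using sub conv_closed[of p q] P(1) Q(1) by blast
qed

lemma conv_word_Nil_left:
  assumes "\<And>u. q u \<in> carrier R"
  shows "conv R (word R []) q w = q w"
proof (cases w)
  case (Cons a w')
  then show ?thesis using assms
    by (simp add: conv_Cons word_def conv_zero_left)
qed (use assms in \<open>simp add: conv_Nil word_def\<close>)

lemma conv_word_Cons_left:
  assumes "\<And>u. q u \<in> carrier R"
  shows "conv R (word R (b # v)) q (a # w) = (if a = b then conv R (word R v) q w else \<zero>)"
proof -
  have "(\<lambda>u. word R (b # v) (a # u)) = (if a = b then word R v else (\<lambda>_. \<zero>))"
    by (auto simp: word_def)
  then show ?thesis using assms
    by (auto simp: conv_Cons conv_zero_left conv_closed) (auto simp: word_def conv_closed conv_Cons conv_zero_left)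
qed

lemma conv_word_word: "conv R (word R u) (word R v) = word R (u @ v)"
proof
  fix w
  have cl: "\<And>u x. word R u x \<in> carrier R" by (simp add: word_def)
  show "conv R (word R u) (word R v) w = word R (u @ v) w"
  proof (induction u arbitrary: w)
    case Nil
    then show ?case by (simp add: conv_word_Nil_left cl)
  next
    case (Cons b u)
    show ?case
    proof (cases w)
      case Nil
      then show ?thesis by (simp add: conv_Nil cl) (simp add: word_def)
    next
      case (Cons a w')
      then show ?thesis using Cons.IH by (simp add: conv_word_Cons_left cl) (simp add: word_def)
    qed
  qed
qed

lemma conv_word_Nil_right:
  assumes "\<And>u. q u \<in> carrier R"
  shows "conv R q (word R []) w = q w"
  using assms
proof (induction w arbitrary: q)
  case (Cons a w)
  then show ?case by (simp add: conv_Cons word_def) 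
qed (simp add: conv_Nil word_def)

lemma free_algebra_abelian_group: "abelian_group (free_algebra R V)"
proof (rule abelian_groupI)
  fix p assume "p \<in> carrier (free_algebra R V)"
  then have p: "p \<in> finsupp R (lists (carrier V))" by (simp add: free_algebra_simps)
  show "\<exists>q\<in>carrier (free_algebra R V). q \<oplus>\<^bsub>free_algebra R V\<^esub> p = \<zero>\<^bsub>free_algebra R V\<^esub>"
    using finsupp_smult[OF p, of "\<ominus> \<one>"] finsuppD(1)[OF p]
    by (intro bexI[of _ "\<lambda>x. \<ominus> \<one> \<otimes> p x"]) (auto simp: free_algebra_simps l_minus l_neg)
qed (auto simp: free_algebra_simps finsupp_zero finsupp_add a_ac finsuppD(1))

lemma free_algebra_module: "module R (free_algebra R V)"
  by (rule moduleI)
     (auto simp: free_algebra_abelian_group is_cring free_algebra_simps finsupp_smult finsuppD(1) l_distr r_distr m_assoc)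

lemma free_algebra_ring: "ring (free_algebra R V)"
proof (rule ringI)
  show "abelian_group (free_algebra R V)" by (rule free_algebra_abelian_group)
  show "Group.monoid (free_algebra R V)"
    by (rule monoidI)
       (auto simp: free_algebra_simps conv_finsupp word_eq_single finsupp_single finsuppD(1) conv_assoc
         conv_word_Nil_left[unfolded word_eq_single] conv_word_Nil_right[unfolded word_eq_single] fun_eq_iff)
qed (auto simp: free_algebra_simps conv_add_left conv_add_right finsuppD(1))

end

section \<open>The tensor algebra\<close>

definition linear_hom ::
    "('r, 'k) ring_scheme \<Rightarrow> ('r, 'm, 'x) module_scheme \<Rightarrow> ('r, 'n, 'y) module_scheme \<Rightarrow> ('m \<Rightarrow> 'n) set"
  where "linear_hom R M N =
    {f \<in> carrier M \<rightarrow> carrier N.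
       (\<forall>x\<in>carrier M. \<forall>y\<in>carrier M. f (x \<oplus>\<^bsub>M\<^esub> y) = f x \<oplus>\<^bsub>N\<^esub> f y) \<and>
       (\<forall>r\<in>carrier R. \<forall>x\<in>carrier M. f (r \<odot>\<^bsub>M\<^esub> x) = r \<odot>\<^bsub>N\<^esub> f x)}"

lemma linear_homI:
  assumes "\<And>x. x \<in> carrier M \<Longrightarrow> f x \<in> carrier N"
    and "\<And>x y. \<lbrakk>x \<in> carrier M; y \<in> carrier M\<rbrakk> \<Longrightarrow> f (x \<oplus>\<^bsub>M\<^esub> y) = f x \<oplus>\<^bsub>N\<^esub> f y"
    and "\<And>r x. \<lbrakk>r \<in> carrier R; x \<in> carrier M\<rbrakk> \<Longrightarrow> f (r \<odot>\<^bsub>M\<^esub> x) = r \<odot>\<^bsub>N\<^esub> f x"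
  shows "f \<in> linear_hom R M N"
  using assms by (simp add: linear_hom_def)

lemma linear_homD:
  assumes "f \<in> linear_hom R M N"
  shows "x \<in> carrier M \<Longrightarrow> f x \<in> carrier N"
    and "\<lbrakk>x \<in> carrier M; y \<in> carrier M\<rbrakk> \<Longrightarrow> f (x \<oplus>\<^bsub>M\<^esub> y) = f x \<oplus>\<^bsub>N\<^esub> f y"
    and "\<lbrakk>r \<in> carrier R; x \<in> carrier M\<rbrakk> \<Longrightarrow> f (r \<odot>\<^bsub>M\<^esub> x) = r \<odot>\<^bsub>N\<^esub> f x"
  using assms by (auto simp: linear_hom_def)

lemma linear_hom_zero:
  assumes "module R M" "module R N" "f \<in> linear_hom R M N"
  shows "f \<zero>\<^bsub>M\<^esub> = \<zero>\<^bsub>N\<^esub>"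
proof -
  interpret M: module R M by fact
  interpret N: module R N by fact
  have "f (\<zero>\<^bsub>R\<^esub> \<odot>\<^bsub>M\<^esub> \<zero>\<^bsub>M\<^esub>) = \<zero>\<^bsub>R\<^esub> \<odot>\<^bsub>N\<^esub> f \<zero>\<^bsub>M\<^esub>"
    by (rule linear_homD(3)[OF assms(3)]) auto
  then show ?thesis using linear_homD(1)[OF assms(3), of "\<zero>\<^bsub>M\<^esub>"] by simp
qed

lemma linear_hom_comp:
  "\<lbrakk>f \<in> linear_hom R L M; g \<in> linear_hom R M N\<rbrakk> \<Longrightarrow> (\<lambda>x. g (f x)) \<in> linear_hom R L N"
  by (auto simp: linear_hom_def Pi_iff)

definition tensor_relations ::
    "('r, 'k) ring_scheme \<Rightarrow> ('r, 'v, 'x) graded_scheme \<Rightarrow> ('v list \<Rightarrow> 'r) set"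
  where "tensor_relations R V = (let F = free_algebra R V in
     {word R [u \<oplus>\<^bsub>V\<^esub> v] \<ominus>\<^bsub>F\<^esub> (word R [u] \<oplus>\<^bsub>F\<^esub> word R [v]) | u v. u \<in> carrier V \<and> v \<in> carrier V} \<union>
     {word R [r \<odot>\<^bsub>V\<^esub> v] \<ominus>\<^bsub>F\<^esub> (r \<odot>\<^bsub>F\<^esub> word R [v]) | r v. r \<in> carrier R \<and> v \<in> carrier V})"

lemma tensor_ideal_eq: "tensor_ideal R V = Idl\<^bsub>free_algebra R V\<^esub> (tensor_relations R V)"
  by (simp add: tensor_ideal_def tensor_relations_def Let_def)

definition word_prod :: "('a, 'x) ring_scheme \<Rightarrow> ('v \<Rightarrow> 'a) \<Rightarrow> 'v list \<Rightarrow> 'a"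
  where "word_prod A f w = foldr (\<lambda>v x. f v \<otimes>\<^bsub>A\<^esub> x) w \<one>\<^bsub>A\<^esub>"

lemma word_prod_simps [simp]:
  "word_prod A f [] = \<one>\<^bsub>A\<^esub>" "word_prod A f (v # w) = f v \<otimes>\<^bsub>A\<^esub> word_prod A f w"
  by (simp_all add: word_prod_def)

text \<open>The algebra map out of the tensor algebra induced by \<open>f\<close>: evaluate a
  representing polynomial. \<open>the_elem\<close> is meaningful because evaluation is constant on
  cosets when \<open>f\<close> is linear, which is the content of
  \<open>tensor_lift_class\<close>.\<close>

definition tensor_lift ::
    "('r, 'k) ring_scheme \<Rightarrow> ('r, 'a, 'x) graded_scheme \<Rightarrow> ('v \<Rightarrow> 'a) \<Rightarrow> ('v list \<Rightarrow> 'r) set \<Rightarrow> 'a"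
  where "tensor_lift R A f C = the_elem (lincomb_of R A (word_prod A f) ` C)"

lemma (in cring) conv_single: "conv R (single R u) (single R v) = single R (u @ v)"
  using conv_word_word by (simp add: word_eq_single)

lemma (in ring) word_prod_closed:
  "f \<in> U \<rightarrow> carrier R \<Longrightarrow> w \<in> lists U \<Longrightarrow> word_prod R f w \<in> carrier R"
  by (induction w) auto

lemma (in ring) word_prod_append:
  "\<lbrakk>f \<in> U \<rightarrow> carrier R; u \<in> lists U; v \<in> lists U\<rbrakk> \<Longrightarrow>
    word_prod R f (u @ v) = word_prod R f u \<otimes> word_prod R f v"
  by (induction u) (auto simp: word_prod_closed m_assoc Pi_iff)

section \<open>Evaluation of noncommutative polynomials in a graded algebra\<close>

context graded_algebra
begin

text \<open>Multiplicativity is obtained one factor at a time: here the left factor is a single word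
  and the right one is built up term by term; \<open>word_eval_mult\<close> then builds up the left
  one.\<close>

lemma word_eval_mult_word:
  assumes f: "f \<in> U \<rightarrow> carrier A" and u: "u \<in> lists U" and q: "q \<in> finsupp R (lists U)"
  shows "lincomb_of R A (word_prod A f) (conv R (single R u) q) =
    word_prod A f u \<otimes>\<^bsub>A\<^esub> lincomb_of R A (word_prod A f) q"
proof -
  have g: "word_prod A f \<in> lists U \<rightarrow> carrier A" using A.word_prod_closed[OF f] by auto
  note gu = A.word_prod_closed[OF f u]
  have su: "single R u \<in> finsupp R (lists U)" using u by (rule finsupp_single)
  show ?thesis using q
  proof (induction rule: finsupp_induct)
    case zero
    then show ?case using gu finsuppD(1)[OF su]
      by (simp add: lincomb_of_zero conv_zero_right)
  next
    case (add c v s)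
    note gv = A.word_prod_closed[OF f add(2)]
    have sv: "single R v \<in> finsupp R (lists U)" using add(2) by (rule finsupp_single)
    have Ec: "lincomb_of R A (word_prod A f) c \<in> carrier A" by (rule lincomb_of_closed[OF add(1) g])
    have "conv R (single R u) (\<lambda>j. s \<otimes> single R v j \<oplus> c j) =
        (\<lambda>w. s \<otimes> single R (u @ v) w \<oplus> conv R (single R u) c w)"
      using finsuppD(1)[OF su] finsuppD(1)[OF sv] finsuppD(1)[OF add(1)] add(3)
      by (simp add: fun_eq_iff conv_add_right conv_smult_right conv_single)
    moreover have "u @ v \<in> lists U" using u add(2) by simp
    ultimately have "lincomb_of R A (word_prod A f) (conv R (single R u) (\<lambda>j. s \<otimes> single R v j \<oplus> c j)) =
        s \<odot>\<^bsub>A\<^esub> word_prod A f (u @ v) \<oplus>\<^bsub>A\<^esub> lincomb_of R A (word_prod A f) (conv R (single R u) c)"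
      using lincomb_of_step[OF conv_finsupp[OF su add(1)] _ add(3) g] by simp
    then show ?case
      using gu gv Ec add(3)
      by (simp add: add(4) A.word_prod_append[OF f u add(2)] lincomb_of_step[OF add(1,2,3) g]
          A.r_distr smult_mult_right)
  qed
qed

lemma word_eval_mult:
  assumes f: "f \<in> U \<rightarrow> carrier A" and p: "p \<in> finsupp R (lists U)" and q: "q \<in> finsupp R (lists U)"
  shows "lincomb_of R A (word_prod A f) (conv R p q) =
    lincomb_of R A (word_prod A f) p \<otimes>\<^bsub>A\<^esub> lincomb_of R A (word_prod A f) q"
proof -
  have g: "word_prod A f \<in> lists U \<rightarrow> carrier A" using A.word_prod_closed[OF f] by auto
  have Eq: "lincomb_of R A (word_prod A f) q \<in> carrier A" by (rule lincomb_of_closed[OF q g])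
  show ?thesis using p
  proof (induction rule: finsupp_induct)
    case zero
    then show ?case using Eq finsuppD(1)[OF q]
      by (simp add: lincomb_of_zero conv_zero_left)
  next
    case (add c u s)
    note gu = A.word_prod_closed[OF f add(2)]
    have su: "single R u \<in> finsupp R (lists U)" using add(2) by (rule finsupp_single)
    have Ec: "lincomb_of R A (word_prod A f) c \<in> carrier A" by (rule lincomb_of_closed[OF add(1) g])
    have "conv R (\<lambda>j. s \<otimes> single R u j \<oplus> c j) q =
        (\<lambda>w. s \<otimes> conv R (single R u) q w \<oplus> conv R c q w)"
      using finsuppD(1)[OF su] finsuppD(1)[OF q] finsuppD(1)[OF add(1)] add(3)
      by (simp add: fun_eq_iff conv_add_left conv_smult_left)
    then have "lincomb_of R A (word_prod A f) (conv R (\<lambda>j. s \<otimes> single R u j \<oplus> c j) q) =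
        s \<odot>\<^bsub>A\<^esub> (word_prod A f u \<otimes>\<^bsub>A\<^esub> lincomb_of R A (word_prod A f) q) \<oplus>\<^bsub>A\<^esub>
        lincomb_of R A (word_prod A f) (conv R c q)"
      by (simp add: lincomb_of_add[OF finsupp_smult[OF conv_finsupp[OF su q] add(3)] conv_finsupp[OF add(1) q] g]
         lincomb_of_smult[OF conv_finsupp[OF su q] add(3) g] word_eval_mult_word[OF f add(2) q])
    then show ?case
      using gu Eq Ec add(3)
      by (simp add: add(4) lincomb_of_step[OF add(1,2,3) g] A.l_distr smult_mult_left)
  qed
qed

end

section \<open>The tensor algebra as a quotient by a two-sided ideal\<close>

context graded_module
begin

interpretation F: ring "free_algebra R M" by (rule free_algebra_ring)
interpretation FM: module R "free_algebra R M" by (rule free_algebra_module)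

lemma tensor_relations_closed:
  "tensor_relations R M \<subseteq> carrier (free_algebra R M)"
proof -
  have "v \<in> carrier M \<Longrightarrow> word R [v] \<in> carrier (free_algebra R M)" for v
    by (simp add: free_algebra_simps word_eq_single finsupp_single)
  then show ?thesis by (auto simp: tensor_relations_def Let_def)
qed

lemma tensor_ideal_ideal: "ideal (tensor_ideal R M) (free_algebra R M)"
  unfolding tensor_ideal_eq by (rule F.genideal_ideal[OF tensor_relations_closed])

interpretation J: ideal "tensor_ideal R M" "free_algebra R M" by (rule tensor_ideal_ideal)

text \<open>The quotient multiplies a coset \<open>C\<close> by forming \<open>I + r C\<close>,
  since \<open>r C\<close> alone may be too small to be a coset. The result is the coset of
  \<open>r p\<close> because the ideal is stable under scalars.\<close>

lemma tensor_class_smult: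
  assumes r: "r \<in> carrier R" and p: "p \<in> carrier (free_algebra R M)"
  shows "r \<odot>\<^bsub>tensor_algebra R M\<^esub> tensor_class R M p = tensor_class R M (r \<odot>\<^bsub>free_algebra R M\<^esub> p)"
proof -
  \<comment> \<open>Scalars act through the unit: \<open>r j = (r 1) j\<close>, and a ring ideal
    absorbs the factor \<open>r 1\<close>.\<close>
  have smJ: "r \<odot>\<^bsub>free_algebra R M\<^esub> j \<in> tensor_ideal R M" if "j \<in> tensor_ideal R M" for j
  proof -
    have j: "j \<in> carrier (free_algebra R M)" using that by simp
    have "(r \<odot>\<^bsub>free_algebra R M\<^esub> \<one>\<^bsub>free_algebra R M\<^esub>) \<otimes>\<^bsub>free_algebra R M\<^esub> j = r \<odot>\<^bsub>free_algebra R M\<^esub> j"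
      using j r by (simp add: free_algebra_simps fun_eq_iff word_eq_single conv_smult_left finsuppD(1)
          finsuppD(1)[OF finsupp_single[OF UNIV_I]] conv_word_Nil_left[unfolded word_eq_single])
    moreover have "r \<odot>\<^bsub>free_algebra R M\<^esub> \<one>\<^bsub>free_algebra R M\<^esub> \<in> carrier (free_algebra R M)" using r by simp
    ultimately show ?thesis using J.I_l_closed[OF that] by metis
  qed
  have cl: "j \<in> tensor_ideal R M \<Longrightarrow> j \<in> carrier (free_algebra R M)" for j by simp
  have "tensor_ideal R M <+>\<^bsub>free_algebra R M\<^esub>
      (\<lambda>x. r \<odot>\<^bsub>free_algebra R M\<^esub> x) ` (tensor_ideal R M +>\<^bsub>free_algebra R M\<^esub> p) =
      tensor_ideal R M +>\<^bsub>free_algebra R M\<^esub> (r \<odot>\<^bsub>free_algebra R M\<^esub> p)" (is "?L = ?R")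
  proof
    show "?L \<subseteq> ?R"
    proof
      fix x assume "x \<in> ?L"
      then obtain i j where ij: "i \<in> tensor_ideal R M" "j \<in> tensor_ideal R M"
        and x: "x = i \<oplus>\<^bsub>free_algebra R M\<^esub> r \<odot>\<^bsub>free_algebra R M\<^esub> (j \<oplus>\<^bsub>free_algebra R M\<^esub> p)"
        unfolding set_add_def' a_r_coset_def' by auto
      have "x = (i \<oplus>\<^bsub>free_algebra R M\<^esub> r \<odot>\<^bsub>free_algebra R M\<^esub> j) \<oplus>\<^bsub>free_algebra R M\<^esub> r \<odot>\<^bsub>free_algebra R M\<^esub> p"
        using cl[OF ij(1)] cl[OF ij(2)] p r by (simp add: x FM.smult_r_distr F.a_assoc)
      moreover have "i \<oplus>\<^bsub>free_algebra R M\<^esub> r \<odot>\<^bsub>free_algebra R M\<^esub> j \<in> tensor_ideal R M"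
        using ij smJ by simp
      ultimately show "x \<in> ?R" unfolding a_r_coset_def' by blast
    qed
    show "?R \<subseteq> ?L"
    proof
      fix x assume "x \<in> ?R"
      then obtain i where i: "i \<in> tensor_ideal R M"
        and x: "x = i \<oplus>\<^bsub>free_algebra R M\<^esub> r \<odot>\<^bsub>free_algebra R M\<^esub> p" unfolding a_r_coset_def' by auto
      have "p \<in> tensor_ideal R M +>\<^bsub>free_algebra R M\<^esub> p" using p by (rule J.a_rcos_self)
      then show "x \<in> ?L" unfolding set_add_def' using i x by blast
    qed
  qed
  then show ?thesis by (simp add: tensor_algebra_def graded_quotient_def tensor_class_def)
qed

lemma tensor_algebra_simps:
  "carrier (tensor_algebra R M) = tensor_class R M ` finsupp R (lists (carrier M))"
  "\<zero>\<^bsub>tensor_algebra R M\<^esub> = tensor_class R M (\<lambda>_. \<zero>)"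
  "\<one>\<^bsub>tensor_algebra R M\<^esub> = tensor_class R M (word R [])"
  "grade (tensor_algebra R M) n = tensor_class R M ` finsupp R {w \<in> lists (carrier M). word_degree M n w}"
proof -
  show "carrier (tensor_algebra R M) = tensor_class R M ` finsupp R (lists (carrier M))"
    by (auto simp: tensor_algebra_def graded_quotient_def FactRing_def A_RCOSETS_def' tensor_class_def
        free_algebra_simps a_r_coset_def')
  show "\<zero>\<^bsub>tensor_algebra R M\<^esub> = tensor_class R M (\<lambda>_. \<zero>)"
    using F.a_coset_add_zero[OF J.a_subset]
    by (simp add: tensor_algebra_def graded_quotient_def FactRing_def tensor_class_def free_algebra_simps)
qed (simp_all add: tensor_algebra_def graded_quotient_def FactRing_def tensor_class_def free_algebra_simps)

lemma tensor_class_add: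
  assumes "p \<in> finsupp R (lists (carrier M))" "q \<in> finsupp R (lists (carrier M))"
  shows "tensor_class R M p \<oplus>\<^bsub>tensor_algebra R M\<^esub> tensor_class R M q = tensor_class R M (\<lambda>w. p w \<oplus> q w)"
  using J.a_rcos_sum[of p q] assms
  by (simp add: tensor_algebra_def graded_quotient_def FactRing_def tensor_class_def free_algebra_simps)

lemma tensor_class_mult:
  assumes "p \<in> finsupp R (lists (carrier M))" "q \<in> finsupp R (lists (carrier M))"
  shows "tensor_class R M p \<otimes>\<^bsub>tensor_algebra R M\<^esub> tensor_class R M q = tensor_class R M (conv R p q)"
  using J.rcoset_mult_add[of p q] assms
  by (simp add: tensor_algebra_def graded_quotient_def FactRing_def tensor_class_def free_algebra_simps)

lemma tensor_class_smult':
  assumes "r \<in> carrier R" "p \<in> finsupp R (lists (carrier M))"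
  shows "r \<odot>\<^bsub>tensor_algebra R M\<^esub> tensor_class R M p = tensor_class R M (\<lambda>w. r \<otimes> p w)"
  using tensor_class_smult[of r p] assms by (simp add: free_algebra_simps)

lemma tensor_class_eqI:
  assumes "p \<in> carrier (free_algebra R M)" "q \<in> carrier (free_algebra R M)"
    and "p \<ominus>\<^bsub>free_algebra R M\<^esub> q \<in> tensor_ideal R M"
  shows "tensor_class R M p = tensor_class R M q"
proof -
  have "p \<in> tensor_ideal R M +>\<^bsub>free_algebra R M\<^esub> q"
    by (rule J.a_rcos_module_minus[THEN iffD2]) (use assms F.ring_axioms in auto)
  then show ?thesis unfolding tensor_class_def
    using J.a_repr_independence'[OF _ assms(2)] by simp
qed

lemma tensor_incl_linear: "tensor_incl R M \<in> linear_hom R M (tensor_algebra R M)"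
proof (rule linear_homI)
  have w: "v \<in> carrier M \<Longrightarrow> word R [v] \<in> finsupp R (lists (carrier M))" for v
    by (simp add: word_eq_single finsupp_single)
  have rel: "x \<in> tensor_ideal R M" if "x \<in> tensor_relations R M" for x
    using F.genideal_self[OF tensor_relations_closed] that unfolding tensor_ideal_eq by blast
  fix u v r assume u: "u \<in> carrier M" 
  show "tensor_incl R M u \<in> carrier (tensor_algebra R M)"
    using w[OF u] by (simp add: tensor_algebra_simps tensor_incl_def)
  { assume v: "v \<in> carrier M"
    have "tensor_class R M (word R [u \<oplus>\<^bsub>M\<^esub> v]) = tensor_class R M (word R [u] \<oplus>\<^bsub>free_algebra R M\<^esub> word R [v])"
    proof (rule tensor_class_eqI)
      show "word R [u \<oplus>\<^bsub>M\<^esub> v] \<ominus>\<^bsub>free_algebra R M\<^esub> (word R [u] \<oplus>\<^bsub>free_algebra R M\<^esub> word R [v]) \<in> tensor_ideal R M"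
        using u v by (intro rel[unfolded tensor_relations_def Let_def]) blast
    qed (use u v w in \<open>auto simp: free_algebra_simps finsupp_add\<close>)
    then show "tensor_incl R M (u \<oplus>\<^bsub>M\<^esub> v) = tensor_incl R M u \<oplus>\<^bsub>tensor_algebra R M\<^esub> tensor_incl R M v"
      using tensor_class_add[OF w[OF u] w[OF v]] by (simp add: tensor_incl_def free_algebra_simps)
  next
    assume r: "r \<in> carrier R"
    have "tensor_class R M (word R [r \<odot>\<^bsub>M\<^esub> u]) = tensor_class R M (r \<odot>\<^bsub>free_algebra R M\<^esub> word R [u])"
    proof (rule tensor_class_eqI)
      show "word R [r \<odot>\<^bsub>M\<^esub> u] \<ominus>\<^bsub>free_algebra R M\<^esub> r \<odot>\<^bsub>free_algebra R M\<^esub> word R [u] \<in> tensor_ideal R M"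
        using r u by (intro rel[unfolded tensor_relations_def Let_def]) blast
    qed (use r u w in \<open>auto simp: free_algebra_simps finsupp_smult\<close>)
    then show "tensor_incl R M (r \<odot>\<^bsub>M\<^esub> u) = r \<odot>\<^bsub>tensor_algebra R M\<^esub> tensor_incl R M u"
      using tensor_class_smult'[OF r w[OF u]] by (simp add: tensor_incl_def free_algebra_simps)
  }
qed

lemma tensor_class_word_Cons:
  assumes "v \<in> carrier M" "w \<in> lists (carrier M)"
  shows "tensor_class R M (word R (v # w)) =
    tensor_incl R M v \<otimes>\<^bsub>tensor_algebra R M\<^esub> tensor_class R M (word R w)"
  using assms by (simp add: tensor_incl_def tensor_class_mult word_eq_single finsupp_single conv_single)

lemma tensor_span_induct [consumes 1, case_names zero add]:
  assumes "x \<in> tensor_span R M Q"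
    and "P \<zero>\<^bsub>tensor_algebra R M\<^esub>"
    and "\<And>x w r. \<lbrakk>x \<in> carrier (tensor_algebra R M); w \<in> lists (carrier M); Q w; r \<in> carrier R; P x\<rbrakk> \<Longrightarrow>
      P (r \<odot>\<^bsub>tensor_algebra R M\<^esub> tensor_class R M (word R w) \<oplus>\<^bsub>tensor_algebra R M\<^esub> x)"
  shows "P x"
proof -
  obtain p where p: "p \<in> finsupp R {w \<in> lists (carrier M). Q w}" and x: "x = tensor_class R M p"
    using assms(1) by (auto simp: tensor_span_def)
  have sub: "finsupp R {w \<in> lists (carrier M). Q w} \<subseteq> finsupp R (lists (carrier M))"
    by (rule finsupp_mono) auto
  from p have "P (tensor_class R M p)"
  proof (induction rule: finsupp_induct)
    case zero
    then show ?case using assms(2) by (simp add: tensor_algebra_simps)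
  next
    case (add c w r)
    have c: "c \<in> finsupp R (lists (carrier M))" using add(1) sub by blast
    have w: "single R w \<in> finsupp R (lists (carrier M))" using add(2) by (simp add: finsupp_single)
    have "P (r \<odot>\<^bsub>tensor_algebra R M\<^esub> tensor_class R M (word R w) \<oplus>\<^bsub>tensor_algebra R M\<^esub> tensor_class R M c)"
      using c add by (intro assms(3)) (auto simp: tensor_algebra_simps)
    then show ?case
      using add(3) c w by (simp add: tensor_class_smult' word_eq_single tensor_class_add finsupp_smult)
  qed
  then show ?thesis by (simp add: x)
qed

lemma tensor_sub_carrier: "tensor_sub R M (carrier M) = carrier (tensor_algebra R M)"
proof -
  have "{w \<in> lists (carrier M). set w \<subseteq> carrier M} = lists (carrier M)" by auto
  then show ?thesis by (simp add: tensor_sub_def tensor_span_def tensor_algebra_simps)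
qed

section \<open>The universal property of the tensor algebra\<close>

context
  fixes A :: "('r, 'e, 'y) graded_scheme" and f
  assumes A: "graded_algebra R A" and f: "f \<in> linear_hom R M A"
begin

interpretation A: graded_algebra R A by (rule A)

lemma linear_hom_funcset: "f \<in> carrier M \<rightarrow> carrier A" using f by (simp add: linear_hom_def)

lemma word_prod_linear_closed: "word_prod A f \<in> lists (carrier M) \<rightarrow> carrier A"
  using A.A.word_prod_closed[OF linear_hom_funcset] by auto

lemma word_eval_hom: "ring_hom_ring (free_algebra R M) A (lincomb_of R A (word_prod A f))"
proof (rule ring_hom_ringI)
  show "ring (free_algebra R M)" by (rule F.ring_axioms)
  show "ring A" by (rule A.A.ring_axioms)
qed (auto simp: free_algebra_simps A.lincomb_of_closed[OF _ word_prod_linear_closed] A.word_eval_mult[OF linear_hom_funcset]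
      A.lincomb_of_add[OF _ _ word_prod_linear_closed] A.lincomb_of_single word_eq_single)

text \<open>Linearity of \<open>f\<close> says exactly that evaluation kills the defining relations.
  Its kernel is an ideal, hence contains the ideal that they generate, so evaluation takes a single
  value on each coset.\<close>

lemma tensor_lift_class:
  assumes p: "p \<in> finsupp R (lists (carrier M))"
  shows "tensor_lift R A f (tensor_class R M p) = lincomb_of R A (word_prod A f) p"
proof -
  interpret E: ring_hom_ring "free_algebra R M" A "lincomb_of R A (word_prod A f)" by (rule word_eval_hom)
  have ev: "v \<in> carrier M \<Longrightarrow> lincomb_of R A (word_prod A f) (word R [v]) = f v" for v
    using linear_homD(1)[OF f] by (simp add: word_eq_single A.lincomb_of_single)
  have w: "v \<in> carrier M \<Longrightarrow> word R [v] \<in> carrier (free_algebra R M)" for v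
    by (simp add: free_algebra_simps word_eq_single finsupp_single)
  have sm: "lincomb_of R A (word_prod A f) (r \<odot>\<^bsub>free_algebra R M\<^esub> p) = r \<odot>\<^bsub>A\<^esub> lincomb_of R A (word_prod A f) p"
    if "r \<in> carrier R" "p \<in> carrier (free_algebra R M)" for r p
    using that A.lincomb_of_smult[OF _ _ word_prod_linear_closed] by (simp add: free_algebra_simps)
  have "tensor_ideal R M \<subseteq> a_kernel (free_algebra R M) A (lincomb_of R A (word_prod A f))"
    unfolding tensor_ideal_eq
  proof (rule F.genideal_minimal[OF E.kernel_is_ideal], rule subsetI)
    fix x assume "x \<in> tensor_relations R M"
    then consider (add) u v where "u \<in> carrier M" "v \<in> carrier M"
        "x = word R [u \<oplus>\<^bsub>M\<^esub> v] \<ominus>\<^bsub>free_algebra R M\<^esub> (word R [u] \<oplus>\<^bsub>free_algebra R M\<^esub> word R [v])"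
      | (smult) r v where "r \<in> carrier R" "v \<in> carrier M"
        "x = word R [r \<odot>\<^bsub>M\<^esub> v] \<ominus>\<^bsub>free_algebra R M\<^esub> (r \<odot>\<^bsub>free_algebra R M\<^esub> word R [v])"
      unfolding tensor_relations_def Let_def by blast
    then show "x \<in> a_kernel (free_algebra R M) A (lincomb_of R A (word_prod A f))"
    proof cases
      case add
      note cl = add(1,2) M.a_closed[OF add(1,2)]
      have "lincomb_of R A (word_prod A f) x = f (u \<oplus>\<^bsub>M\<^esub> v) \<oplus>\<^bsub>A\<^esub> \<ominus>\<^bsub>A\<^esub> (f u \<oplus>\<^bsub>A\<^esub> f v)"
        unfolding add(3) a_minus_def
        by (simp only: E.hom_add E.hom_a_inv F.a_inv_closed F.a_closed cl[THEN w] cl[THEN ev])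
      also have "\<dots> = \<zero>\<^bsub>A\<^esub>"
        unfolding linear_homD(2)[OF f add(1,2)] by (intro A.M.r_neg A.M.a_closed linear_homD(1)[OF f] cl)
      finally have "lincomb_of R A (word_prod A f) x = \<zero>\<^bsub>A\<^esub>" .
      moreover have "x \<in> carrier (free_algebra R M)"
        unfolding add(3) by (intro F.minus_closed F.a_closed w cl)
      ultimately show ?thesis unfolding a_kernel_def' by blast
    next
      case smult
      note cl = smult(2) smult_closed[OF smult(1,2)]
      have "lincomb_of R A (word_prod A f) x = f (r \<odot>\<^bsub>M\<^esub> v) \<oplus>\<^bsub>A\<^esub> \<ominus>\<^bsub>A\<^esub> (r \<odot>\<^bsub>A\<^esub> f v)"
        unfolding smult(3) a_minus_def
        by (simp only: E.hom_add E.hom_a_inv F.a_inv_closed FM.smult_closed smult(1) cl[THEN w] cl[THEN ev] sm)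
      also have "\<dots> = \<zero>\<^bsub>A\<^esub>"
        unfolding linear_homD(3)[OF f smult(1,2)] by (intro A.M.r_neg A.smult_closed linear_homD(1)[OF f] cl smult)
      finally have "lincomb_of R A (word_prod A f) x = \<zero>\<^bsub>A\<^esub>" .
      moreover have "x \<in> carrier (free_algebra R M)"
        unfolding smult(3) by (intro F.minus_closed FM.smult_closed smult w cl)
      ultimately show ?thesis unfolding a_kernel_def' by blast
    qed
  qed
  then have "j \<in> tensor_ideal R M \<Longrightarrow> lincomb_of R A (word_prod A f) j = \<zero>\<^bsub>A\<^esub>" for j
    unfolding a_kernel_def' by blast
  moreover have p': "p \<in> carrier (free_algebra R M)" using p by (simp add: free_algebra_simps)
  ultimately have "lincomb_of R A (word_prod A f) (j \<oplus>\<^bsub>free_algebra R M\<^esub> p) = lincomb_of R A (word_prod A f) p"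
    if "j \<in> tensor_ideal R M" for j
    using that E.hom_add[OF J.a_Hcarr[OF that] p'] A.M.l_zero[OF E.hom_closed[OF p']] by simp
  then have "x \<in> tensor_class R M p \<Longrightarrow>
      lincomb_of R A (word_prod A f) x = lincomb_of R A (word_prod A f) p" for x
    unfolding tensor_class_def a_r_coset_def' by blast
  moreover have "p \<in> tensor_class R M p" unfolding tensor_class_def using p' by (rule J.a_rcos_self)
  ultimately have "lincomb_of R A (word_prod A f) ` tensor_class R M p = {lincomb_of R A (word_prod A f) p}"
    by blast
  then show ?thesis by (simp add: tensor_lift_def)
qed

lemma tensor_lift_word:
  "w \<in> lists (carrier M) \<Longrightarrow> tensor_lift R A f (tensor_class R M (word R w)) = word_prod A f w"
  by (simp add: tensor_lift_class word_eq_single finsupp_single A.lincomb_of_single funcset_mem[OF word_prod_linear_closed])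

lemma tensor_lift_incl: "v \<in> carrier M \<Longrightarrow> tensor_lift R A f (tensor_incl R M v) = f v"
  using linear_homD(1)[OF f] by (simp add: tensor_incl_def tensor_lift_word)

lemma tensor_lift_ring_hom: "tensor_lift R A f \<in> ring_hom (tensor_algebra R M) A"
proof (rule ring_hom_memI)
  show "tensor_lift R A f \<one>\<^bsub>tensor_algebra R M\<^esub> = \<one>\<^bsub>A\<^esub>"
    by (simp add: tensor_algebra_simps tensor_lift_word)
next
  fix x y assume "x \<in> carrier (tensor_algebra R M)" "y \<in> carrier (tensor_algebra R M)"
  then obtain p q where p: "p \<in> finsupp R (lists (carrier M))" and q: "q \<in> finsupp R (lists (carrier M))"
    and [simp]: "x = tensor_class R M p" "y = tensor_class R M q"
    unfolding tensor_algebra_simps by blast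
  show "tensor_lift R A f x \<in> carrier A"
    by (simp add: tensor_lift_class p A.lincomb_of_closed[OF p word_prod_linear_closed])
  show "tensor_lift R A f (x \<otimes>\<^bsub>tensor_algebra R M\<^esub> y) = tensor_lift R A f x \<otimes>\<^bsub>A\<^esub> tensor_lift R A f y"
    by (simp add: tensor_lift_class p q tensor_class_mult conv_finsupp A.word_eval_mult[OF linear_hom_funcset p q])
  show "tensor_lift R A f (x \<oplus>\<^bsub>tensor_algebra R M\<^esub> y) = tensor_lift R A f x \<oplus>\<^bsub>A\<^esub> tensor_lift R A f y"
    by (simp add: tensor_lift_class p q tensor_class_add finsupp_add A.lincomb_of_add[OF p q word_prod_linear_closed])
qed

lemma tensor_lift_linear: "tensor_lift R A f \<in> linear_hom R (tensor_algebra R M) A"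
proof (rule linear_homI)
  show "tensor_lift R A f (r \<odot>\<^bsub>tensor_algebra R M\<^esub> x) = r \<odot>\<^bsub>A\<^esub> tensor_lift R A f x"
    if "r \<in> carrier R" "x \<in> carrier (tensor_algebra R M)" for r x
    using that by (auto simp: tensor_algebra_simps tensor_class_smult' tensor_lift_class finsupp_smult
        A.lincomb_of_smult[OF _ _ word_prod_linear_closed])
qed (use tensor_lift_ring_hom in \<open>auto simp: ring_hom_def\<close>)

text \<open>A class of degree \<open>n\<close> has a representative supported on words with
  homogeneous letters of total degree \<open>n\<close>. Each such word evaluates into
  \<open>grade A n\<close>, and this is a submodule.\<close>

lemma tensor_lift_graded:
  assumes deg: "\<And>n v. v \<in> grade M n \<Longrightarrow> f v \<in> grade A n"
  shows "tensor_lift R A f \<in> graded_algebra_hom R (tensor_algebra R M) A"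
proof -
  have wd: "word_prod A f w \<in> grade A n" if wn: "word_degree M n w" for w n
  proof -
    obtain ns where "list_all2 (\<lambda>v i. v \<in> grade M i) w ns" "sum_list ns = n"
      using wn by (auto simp: word_degree_def)
    then show ?thesis
    proof (induction w ns arbitrary: n rule: list_all2_induct)
      case Nil
      then show ?case using A.one_grade by simp
    next
      case (Cons v w i ns)
      then show ?case using A.mult_grade[OF deg[OF Cons(1)]] by auto
    qed
  qed
  have "tensor_lift R A f x \<in> grade A n" if x: "x \<in> grade (tensor_algebra R M) n" for x n
  proof -
    obtain p where p: "p \<in> finsupp R {w \<in> lists (carrier M). word_degree M n w}"
      and xp: "x = tensor_class R M p" using x by (auto simp: tensor_algebra_simps)
    have "p \<in> finsupp R (lists (carrier M))"
      using p finsupp_mono[of "{w \<in> lists (carrier M). word_degree M n w}" "lists (carrier M)"] by blast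
    then have "tensor_lift R A f x = lincomb_of R A (word_prod A f) p" by (simp add: xp tensor_lift_class)
    also have "\<dots> \<in> grade A n"
      by (rule A.lincomb_of_mem_submodule[OF p A.grade_submodule]) (use wd in auto)
    finally show ?thesis .
  qed
  then show ?thesis using tensor_lift_ring_hom linear_homD(3)[OF tensor_lift_linear]
    by (auto simp: graded_algebra_hom_def)
qed

end

end

section \<open>Homogeneous components\<close>

text \<open>The projection onto degree \<open>n\<close>, meant for elements of the carrier, where
  \<open>grade_decomp\<close> makes the description unique. It is what turns arbitrary preimages
  into homogeneous ones.\<close>

definition component :: "('r, 'm, 'x) graded_scheme \<Rightarrow> int \<Rightarrow> 'm \<Rightarrow> 'm"
  where "component M n x = (THE c. (\<forall>n. c n \<in> grade M n) \<and> finite {n. c n \<noteq> \<zero>\<^bsub>M\<^esub>} \<and>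
    x = (\<Oplus>\<^bsub>M\<^esub>n\<in>{n. c n \<noteq> \<zero>\<^bsub>M\<^esub>}. c n)) n"

context graded_module
begin

lemma grade_closed: "x \<in> grade M n \<Longrightarrow> x \<in> carrier M"
  using submoduleE(1)[OF grade_submodule] by blast

lemma grade_zero: "\<zero>\<^bsub>M\<^esub> \<in> grade M n"
  using subgroup.one_closed[OF submodule.axioms(1)[OF grade_submodule]] by simp

lemma grade_add: "x \<in> grade M n \<Longrightarrow> y \<in> grade M n \<Longrightarrow> x \<oplus>\<^bsub>M\<^esub> y \<in> grade M n"
  using submoduleE(5)[OF grade_submodule] by blast

lemma component_decomp:
  assumes "x \<in> carrier M"
  shows "component M n x \<in> grade M n" "finite {n. component M n x \<noteq> \<zero>\<^bsub>M\<^esub>}"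
    "x = (\<Oplus>\<^bsub>M\<^esub>n\<in>{n. component M n x \<noteq> \<zero>\<^bsub>M\<^esub>}. component M n x)"
  using theI'[OF grade_decomp[OF assms]] unfolding component_def[symmetric] by blast+

text \<open>Any finite \<open>J\<close> containing the support is allowed, so a decomposition is
  recognised without computing its exact support.\<close>

lemma component_eqI:
  assumes c: "\<And>n. c n \<in> grade M n" and J: "finite J" "\<And>n. n \<notin> J \<Longrightarrow> c n = \<zero>\<^bsub>M\<^esub>"
    and x: "x = (\<Oplus>\<^bsub>M\<^esub>n\<in>J. c n)"
  shows "component M n x = c n"
proof -
  have sub: "{n. c n \<noteq> \<zero>\<^bsub>M\<^esub>} \<subseteq> J" using J(2) by auto
  have cM: "c n \<in> carrier M" for n using c by (rule grade_closed)
  have "x = (\<Oplus>\<^bsub>M\<^esub>n\<in>{n. c n \<noteq> \<zero>\<^bsub>M\<^esub>}. c n)"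
    unfolding x by (rule M.add.finprod_mono_neutral_cong_right) (use J sub cM in auto)
  then have P: "(\<forall>n. c n \<in> grade M n) \<and> finite {n. c n \<noteq> \<zero>\<^bsub>M\<^esub>} \<and> x = (\<Oplus>\<^bsub>M\<^esub>n\<in>{n. c n \<noteq> \<zero>\<^bsub>M\<^esub>}. c n)"
    using c finite_subset[OF sub J(1)] by blast
  have xM: "x \<in> carrier M" unfolding x by (rule M.finsum_closed) (use cM in auto)
  show ?thesis unfolding component_def using the1_equality[OF grade_decomp[OF xM], OF P] by (simp only:)
qed

lemma component_homogeneous:
  assumes "x \<in> grade M n"
  shows "component M m x = (if m = n then x else \<zero>\<^bsub>M\<^esub>)"
  by (rule component_eqI[where J = "{n}"])
     (use assms grade_closed[OF assms] in \<open>auto simp: grade_zero\<close>)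

lemma component_add:
  assumes x: "x \<in> carrier M" and y: "y \<in> carrier M"
  shows "component M n (x \<oplus>\<^bsub>M\<^esub> y) = component M n x \<oplus>\<^bsub>M\<^esub> component M n y"
proof -
  define J where "J = {n. component M n x \<noteq> \<zero>\<^bsub>M\<^esub>} \<union> {n. component M n y \<noteq> \<zero>\<^bsub>M\<^esub>}"
  have J: "finite J" using component_decomp(2) x y by (simp add: J_def)
  have cl: "\<And>n. component M n x \<in> carrier M" "\<And>n. component M n y \<in> carrier M"
    using component_decomp(1) x y grade_closed by blast+
  have ext: "z = (\<Oplus>\<^bsub>M\<^esub>n\<in>J. component M n z)"
    if "z \<in> carrier M" "{n. component M n z \<noteq> \<zero>\<^bsub>M\<^esub>} \<subseteq> J" for z
    by (subst (1) component_decomp(3)[OF that(1)], rule M.add.finprod_mono_neutral_cong_left)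
       (use J that component_decomp(1)[OF that(1)] grade_closed in auto)
  have "x \<oplus>\<^bsub>M\<^esub> y = (\<Oplus>\<^bsub>M\<^esub>n\<in>J. component M n x) \<oplus>\<^bsub>M\<^esub> (\<Oplus>\<^bsub>M\<^esub>n\<in>J. component M n y)"
    using ext[OF x] ext[OF y] by (simp add: J_def)
  also have "\<dots> = (\<Oplus>\<^bsub>M\<^esub>n\<in>J. component M n x \<oplus>\<^bsub>M\<^esub> component M n y)"
    by (rule M.finsum_addf[symmetric]) (use cl in auto)
  finally show ?thesis
    by (intro component_eqI[where J = J]) (use x y J component_decomp(1) in \<open>auto simp: grade_add J_def\<close>)
qed

lemma homogeneous_induct [consumes 1, case_names zero add]:
  assumes x: "x \<in> carrier M" and zero: "P \<zero>\<^bsub>M\<^esub>"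
    and add: "\<And>y z n. \<lbrakk>y \<in> carrier M; z \<in> grade M n; P y\<rbrakk> \<Longrightarrow> P (z \<oplus>\<^bsub>M\<^esub> y)"
  shows "P x"
proof -
  have cl: "\<And>n. component M n x \<in> carrier M"
    using component_decomp(1) x grade_closed by blast
  have "P (\<Oplus>\<^bsub>M\<^esub>n\<in>J. component M n x)" if "finite J" for J
    using that
  proof (induction J rule: finite_induct)
    case (insert n J)
    have "(\<Oplus>\<^bsub>M\<^esub>n\<in>J. component M n x) \<in> carrier M" by (rule M.finsum_closed) (use cl in auto)
    then show ?case
      using add[OF _ component_decomp(1)[OF x, of n] insert.IH] insert.hyps cl by simp
  qed (simp add: zero)
  then show ?thesis
    by (subst component_decomp(3)[OF x]) (use component_decomp(2)[OF x] in blast)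
qed

text \<open>Used with \<open>e = 0\<close> for \<eta> and \<open>e = 1\<close> for the differential:
  if \<open>a\<close> solves \<eta> a = b and d a = z with homogeneous right-hand sides, then its
  component in the degree of \<open>b\<close> solves both equations too.\<close>

lemma component_linear_hom:
  assumes N: "graded_module R N" and h: "h \<in> linear_hom R M N"
    and deg: "\<And>n x. x \<in> grade M n \<Longrightarrow> h x \<in> grade N (n + e)" and x: "x \<in> carrier M"
  shows "component N (n + e) (h x) = h (component M n x)"
proof -
  interpret N: graded_module R N by fact
  have h0: "h \<zero>\<^bsub>M\<^esub> = \<zero>\<^bsub>N\<^esub>" by (rule linear_hom_zero[OF module_axioms N.module_axioms h])
  show ?thesis using x
  proof (induction rule: homogeneous_induct)
    case zero
    show ?case using N.component_homogeneous[OF N.grade_zero] component_homogeneous[OF grade_zero]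
      by (simp add: h0)
  next
    case (add y z m)
    have z: "z \<in> carrier M" using add(2) by (rule grade_closed)
    have "component M n z \<in> carrier M" "component M n y \<in> carrier M"
      using component_decomp(1) add(1) z grade_closed by blast+
    then show ?case
      using add z linear_homD[OF h] h0
      by (simp add: component_add N.component_add component_homogeneous[OF add(2)]
          N.component_homogeneous[OF deg[OF add(2)]])
  qed
qed

end

section \<open>Bases adapted to a filtration\<close>

text \<open>A basis of \<open>N\<close> written with the operations of the ambient \<open>M\<close>.
  With \<open>module_basis\<close> on restricted structures, bases of different stages would live
  over different records and could not be united.\<close>

definition free_on ::
    "('r, 'k) ring_scheme \<Rightarrow> ('r, 'm, 'x) module_scheme \<Rightarrow> 'm set \<Rightarrow> 'm set \<Rightarrow> bool"
  where "free_on R M S N \<longleftrightarrow> S \<subseteq> carrier M \<and> bij_betw (lincomb R M) (finsupp R S) N"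

lemma (in cring) finsupp_empty: "finsupp R {} = {\<lambda>_. \<zero>}"
  by (auto simp: finsupp_def)

text \<open>A finite set covered by an increasing chain lies in one member of it; the induction
  takes the \<open>max\<close> of the stage of the old support and the stage of the new
  index.\<close>

lemma (in cring) finsupp_UN_chain:
  fixes B :: "nat \<Rightarrow> 'i set"
  assumes "mono B"
  shows "finsupp R (\<Union>k. B k) = (\<Union>k. finsupp R (B k))"
proof
  show "finsupp R (\<Union>k. B k) \<subseteq> (\<Union>k. finsupp R (B k))"
  proof
    fix c assume "c \<in> finsupp R (\<Union>k. B k)"
    then show "c \<in> (\<Union>k. finsupp R (B k))"
    proof (induction rule: finsupp_induct)
      case zero
      then show ?case using finsupp_zero by blast
    next
      case (add c i r)
      then obtain k l where kl: "c \<in> finsupp R (B k)" "i \<in> B l" by blast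
      have "B k \<subseteq> B (max k l)" "B l \<subseteq> B (max k l)" using assms by (simp_all add: monoD)
      then have "c \<in> finsupp R (B (max k l))" "i \<in> B (max k l)"
        using kl finsupp_mono by blast+
      then have "(\<lambda>j. r \<otimes> single R i j \<oplus> c j) \<in> finsupp R (B (max k l))"
        using add(3) by (intro finsupp_add finsupp_smult finsupp_single)
      then show ?case by blast
    qed
  qed
  show "(\<Union>k. finsupp R (B k)) \<subseteq> finsupp R (\<Union>k. B k)"
    by (intro UN_least finsupp_mono) auto
qed

section \<open>Bases of direct sums and of increasing unions\<close>

context module
begin

lemma lincomb_add:
  assumes "S \<subseteq> carrier M" "c \<in> finsupp R S" "c' \<in> finsupp R S"
  shows "lincomb R M (\<lambda>x. c x \<oplus> c' x) = lincomb R M c \<oplus>\<^bsub>M\<^esub> lincomb R M c'"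
  unfolding lincomb_eq_lincomb_of by (rule lincomb_of_add[OF assms(2,3)]) (use assms(1) in auto)

lemma lincomb_smult:
  assumes "S \<subseteq> carrier M" "c \<in> finsupp R S" "r \<in> carrier R"
  shows "lincomb R M (\<lambda>x. r \<otimes> c x) = r \<odot>\<^bsub>M\<^esub> lincomb R M c"
  unfolding lincomb_eq_lincomb_of by (rule lincomb_of_smult[OF assms(2,3)]) (use assms(1) in auto)

lemma lincomb_zero: "lincomb R M (\<lambda>_. \<zero>) = \<zero>\<^bsub>M\<^esub>"
  by (simp add: lincomb_eq_lincomb_of lincomb_of_zero)

lemma lincomb_single: "s \<in> carrier M \<Longrightarrow> lincomb R M (single R s) = s"
  by (simp add: lincomb_eq_lincomb_of lincomb_of_single)

lemma free_on_induct [consumes 2, case_names zero add]: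
  assumes S: "free_on R M S N" and x: "x \<in> N" and zero: "P \<zero>\<^bsub>M\<^esub>"
    and add: "\<And>s r y. \<lbrakk>s \<in> S; r \<in> carrier R; y \<in> carrier M; P y\<rbrakk> \<Longrightarrow> P (r \<odot>\<^bsub>M\<^esub> s \<oplus>\<^bsub>M\<^esub> y)"
  shows "P x"
proof -
  have S': "(\<lambda>x. x) \<in> S \<rightarrow> carrier M" using S by (auto simp: free_on_def)
  obtain c where c: "c \<in> finsupp R S" "x = lincomb_of R M (\<lambda>x. x) c"
    using S x by (auto simp: free_on_def bij_betw_def lincomb_eq_lincomb_of)
  from c(1) have "P (lincomb_of R M (\<lambda>x. x) c)"
  proof (induction rule: finsupp_induct)
    case zero
    then show ?case using assms(3) by (simp add: lincomb_of_zero)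
  next
    case (add c i r)
    then show ?case using lincomb_of_closed[OF add(1) S'] assms(4)
      by (simp add: lincomb_of_step[OF add(1,2,3) S'])
  qed
  then show ?thesis using c(2) by simp
qed

lemma inj_on_lincombI:
  assumes S: "S \<subseteq> carrier M"
    and ker: "\<And>c. \<lbrakk>c \<in> finsupp R S; lincomb R M c = \<zero>\<^bsub>M\<^esub>\<rbrakk> \<Longrightarrow> c = (\<lambda>_. \<zero>)"
  shows "inj_on (lincomb R M) (finsupp R S)"
proof (rule inj_onI)
  fix c c' assume c: "c \<in> finsupp R S" and c': "c' \<in> finsupp R S" and eq: "lincomb R M c = lincomb R M c'"
  have m: "\<ominus> \<one> \<in> carrier R" by simp
  have cl: "lincomb R M c' \<in> carrier M"
    unfolding lincomb_eq_lincomb_of by (rule lincomb_of_closed[OF c']) (use S in auto)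
  have "lincomb R M (\<lambda>x. c x \<oplus> \<ominus> \<one> \<otimes> c' x) = lincomb R M c \<oplus>\<^bsub>M\<^esub> (\<ominus> \<one>) \<odot>\<^bsub>M\<^esub> lincomb R M c'"
    by (simp only: lincomb_add[OF S c finsupp_smult[OF c' m]] lincomb_smult[OF S c' m])
  also have "\<dots> = \<zero>\<^bsub>M\<^esub>" using cl by (simp add: eq smult_l_minus M.r_neg)
  finally have z: "(\<lambda>x. c x \<oplus> \<ominus> \<one> \<otimes> c' x) = (\<lambda>_. \<zero>)"
    by (intro ker finsupp_add c finsupp_smult c' m)
  show "c = c'"
  proof
    fix x
    have cx: "c x \<in> carrier R" "c' x \<in> carrier R" using finsuppD(1) c c' by metis+
    have "c x \<oplus> \<ominus> (c' x) = \<zero>" using fun_cong[OF z, of x] cx by (simp add: l_minus)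
    then show "c x = c' x" using cx R.minus_unique by (metis R.add.inv_closed R.add.inv_solve_right' R.l_zero R.zero_closed)
  qed
qed

text \<open>Coefficients are split along \<open>S1\<close> and its complement. If the total
  vanishes, the two partial sums are opposite, so both lie in \<open>N1 \<inter> N2\<close> and are
  zero; freeness of each part then kills the coefficients.\<close>

lemma free_on_Un:
  assumes S1: "free_on R M S1 N1" and S2: "free_on R M S2 N2"
    and N1: "submodule N1 R M" and N2: "submodule N2 R M" and int: "N1 \<inter> N2 = {\<zero>\<^bsub>M\<^esub>}"
  shows "free_on R M (S1 \<union> S2) (N1 <+>\<^bsub>M\<^esub> N2)"
proof -
  have c12: "S1 \<subseteq> carrier M" "S2 \<subseteq> carrier M" using S1 S2 by (auto simp: free_on_def)
  then have S: "S1 \<union> S2 \<subseteq> carrier M" by blast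
  have im: "lincomb R M ` finsupp R S1 = N1" "lincomb R M ` finsupp R S2 = N2"
    using S1 S2 by (auto simp: free_on_def bij_betw_def)
  have sub: "finsupp R S1 \<subseteq> finsupp R (S1 \<union> S2)" "finsupp R S2 \<subseteq> finsupp R (S1 \<union> S2)"
    by (auto intro: finsupp_mono[THEN subsetD])
  have split: "\<exists>c1\<in>finsupp R S1. \<exists>c2\<in>finsupp R S2. c = (\<lambda>x. c1 x \<oplus> c2 x)"
    if c: "c \<in> finsupp R (S1 \<union> S2)" for c
  proof (intro bexI)
    show "c = (\<lambda>x. (if x \<in> S1 then c x else \<zero>) \<oplus> (if x \<in> - S1 then c x else \<zero>))"
      using finsuppD(1)[OF c] by auto
    show "(\<lambda>x. if x \<in> S1 then c x else \<zero>) \<in> finsupp R S1"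
      using finsupp_restrict[OF c, of S1] finsupp_mono[of "(S1 \<union> S2) \<inter> S1" S1] by blast
    show "(\<lambda>x. if x \<in> - S1 then c x else \<zero>) \<in> finsupp R S2"
      using finsupp_restrict[OF c, of "- S1"] finsupp_mono[of "(S1 \<union> S2) \<inter> - S1" S2] by blast
  qed
  have add: "lincomb R M (\<lambda>x. c1 x \<oplus> c2 x) = lincomb R M c1 \<oplus>\<^bsub>M\<^esub> lincomb R M c2"
    if "c1 \<in> finsupp R S1" "c2 \<in> finsupp R S2" for c1 c2
    by (rule lincomb_add[OF S]) (use that sub in blast)+
  have "inj_on (lincomb R M) (finsupp R (S1 \<union> S2))"
  proof (rule inj_on_lincombI[OF S])
    fix c assume "c \<in> finsupp R (S1 \<union> S2)" and 0: "lincomb R M c = \<zero>\<^bsub>M\<^esub>"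
    then obtain c1 c2 where c: "c1 \<in> finsupp R S1" "c2 \<in> finsupp R S2" "c = (\<lambda>x. c1 x \<oplus> c2 x)"
      using split by blast
    have m: "lincomb R M c1 \<in> N1" "lincomb R M c2 \<in> N2" using c im by blast+
    then have cl: "lincomb R M c1 \<in> carrier M" "lincomb R M c2 \<in> carrier M"
      using submoduleE(1) N1 N2 by blast+
    have "lincomb R M c1 \<oplus>\<^bsub>M\<^esub> lincomb R M c2 = \<zero>\<^bsub>M\<^esub>" using 0 add[OF c(1,2)] c(3) by simp
    then have "lincomb R M c2 = \<ominus>\<^bsub>M\<^esub> lincomb R M c1"
      using cl by (metis M.minus_equality M.minus_minus M.a_comm)
    then have "lincomb R M c2 \<in> N1" using m(1) submoduleE(3)[OF N1] by simp
    then have z2: "lincomb R M c2 = \<zero>\<^bsub>M\<^esub>" using m(2) int by blast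
    then have z1: "lincomb R M c1 = \<zero>\<^bsub>M\<^esub>"
      using \<open>lincomb R M c1 \<oplus>\<^bsub>M\<^esub> lincomb R M c2 = \<zero>\<^bsub>M\<^esub>\<close> cl by simp
    have "c1 = (\<lambda>_. \<zero>)" "c2 = (\<lambda>_. \<zero>)"
      using S1 S2 z1 z2 c(1,2) lincomb_zero finsupp_zero
      unfolding free_on_def bij_betw_def inj_on_def by metis+
    then show "c = (\<lambda>_. \<zero>)" using c(3) by simp
  qed
  moreover have "lincomb R M ` finsupp R (S1 \<union> S2) = N1 <+>\<^bsub>M\<^esub> N2"
  proof
    show "lincomb R M ` finsupp R (S1 \<union> S2) \<subseteq> N1 <+>\<^bsub>M\<^esub> N2"
    proof (rule image_subsetI)
      fix c assume "c \<in> finsupp R (S1 \<union> S2)"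
      then obtain c1 c2 where c: "c1 \<in> finsupp R S1" "c2 \<in> finsupp R S2" "c = (\<lambda>x. c1 x \<oplus> c2 x)"
        using split by blast
      have "lincomb R M c1 \<in> N1" "lincomb R M c2 \<in> N2" using c(1,2) im by blast+
      then show "lincomb R M c \<in> N1 <+>\<^bsub>M\<^esub> N2"
        unfolding c(3) add[OF c(1,2)] set_add_def' by blast
    qed
    show "N1 <+>\<^bsub>M\<^esub> N2 \<subseteq> lincomb R M ` finsupp R (S1 \<union> S2)"
    proof
      fix x assume "x \<in> N1 <+>\<^bsub>M\<^esub> N2"
      then obtain n1 n2 where n: "n1 \<in> N1" "n2 \<in> N2" "x = n1 \<oplus>\<^bsub>M\<^esub> n2"
        unfolding set_add_def' by blast
      obtain c1 where c1: "c1 \<in> finsupp R S1" "n1 = lincomb R M c1" using n(1) im(1) by blast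
      obtain c2 where c2: "c2 \<in> finsupp R S2" "n2 = lincomb R M c2" using n(2) im(2) by blast
      have "x = lincomb R M (\<lambda>x. c1 x \<oplus> c2 x)" using add[OF c1(1) c2(1)] n(3) c1(2) c2(2) by simp
      moreover have "(\<lambda>x. c1 x \<oplus> c2 x) \<in> finsupp R (S1 \<union> S2)"
        using c1(1) c2(1) sub by (intro finsupp_add) blast+
      ultimately show "x \<in> lincomb R M ` finsupp R (S1 \<union> S2)" by (rule image_eqI)
    qed
  qed
  ultimately show ?thesis using S by (simp add: free_on_def bij_betw_def)
qed

lemma free_on_empty: "free_on R M {} {\<zero>\<^bsub>M\<^esub>}"
  by (simp add: finsupp_empty free_on_def bij_betw_def lincomb_zero)

text \<open>Injectivity concerns only two coefficient families at a time, and these are supported on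
  a common stage.\<close>

lemma free_on_UN_chain:
  fixes B :: "nat \<Rightarrow> _"
  assumes "mono B" and free: "\<And>k. free_on R M (B k) (U k)"
  shows "free_on R M (\<Union>k. B k) (\<Union>k. U k)"
proof -
  have "inj_on (lincomb R M) (\<Union>k. finsupp R (B k))"
  proof (rule inj_onI)
    fix c c' assume "c \<in> (\<Union>k. finsupp R (B k))" "c' \<in> (\<Union>k. finsupp R (B k))"
      and eq: "lincomb R M c = lincomb R M c'"
    then obtain k l where kl: "c \<in> finsupp R (B k)" "c' \<in> finsupp R (B l)" by blast
    have "B k \<subseteq> B (max k l)" "B l \<subseteq> B (max k l)" using assms(1) by (simp_all add: monoD)
    then have "c \<in> finsupp R (B (max k l))" "c' \<in> finsupp R (B (max k l))"
      using kl finsupp_mono by blast+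
    moreover have "inj_on (lincomb R M) (finsupp R (B (max k l)))"
      using free[of "max k l"] by (simp add: free_on_def bij_betw_def)
    ultimately show "c = c'" using eq by (simp add: inj_on_eq_iff)
  qed
  then show ?thesis
    using free unfolding free_on_def bij_betw_def finsupp_UN_chain[OF assms(1)] image_UN by blast
qed

lemma free_on_extend:
  assumes S: "free_on R M S (carrier M)" and N: "module R N" and g: "g \<in> S \<rightarrow> carrier N"
  shows "\<exists>f\<in>linear_hom R M N. \<forall>s\<in>S. f s = g s"
proof -
  interpret N: module R N by fact
  have SM: "S \<subseteq> carrier M" and bij: "bij_betw (lincomb R M) (finsupp R S) (carrier M)"
    using S by (auto simp: free_on_def)
  \<comment> \<open>Coordinates with respect to \<open>S\<close>. Their linearity is read off from
    uniqueness: the expected coefficients yield the right element.\<close>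
  define co where "co = inv_into (finsupp R S) (lincomb R M)"
  have co: "co x \<in> finsupp R S" "lincomb R M (co x) = x" if "x \<in> carrier M" for x
    unfolding co_def using bij that by (auto simp: bij_betw_def inv_into_into f_inv_into_f)
  have uniq: "co x = c" if "c \<in> finsupp R S" "lincomb R M c = x" for c x
    unfolding co_def using bij that by (auto simp: bij_betw_def)
  show ?thesis
  proof (intro bexI ballI)
    show "(\<lambda>x. lincomb_of R N g (co x)) \<in> linear_hom R M N"
    proof (rule linear_homI)
      fix x y assume x: "x \<in> carrier M" and y: "y \<in> carrier M"
      have "co (x \<oplus>\<^bsub>M\<^esub> y) = (\<lambda>s. co x s \<oplus> co y s)"
        by (rule uniq) (use x y co in \<open>simp_all add: finsupp_add lincomb_add[OF SM]\<close>)
      then show "lincomb_of R N g (co (x \<oplus>\<^bsub>M\<^esub> y)) = lincomb_of R N g (co x) \<oplus>\<^bsub>N\<^esub> lincomb_of R N g (co y)"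
        using N.lincomb_of_add[OF co(1)[OF x] co(1)[OF y] g] by simp
    next
      fix r x assume r: "r \<in> carrier R" and x: "x \<in> carrier M"
      have "co (r \<odot>\<^bsub>M\<^esub> x) = (\<lambda>s. r \<otimes> co x s)"
        by (rule uniq) (use r x co in \<open>simp_all add: finsupp_smult lincomb_smult[OF SM]\<close>)
      then show "lincomb_of R N g (co (r \<odot>\<^bsub>M\<^esub> x)) = r \<odot>\<^bsub>N\<^esub> lincomb_of R N g (co x)"
        using N.lincomb_of_smult[OF co(1)[OF x] r g] by simp
    qed (use N.lincomb_of_closed[OF co(1) g] in blast)
    fix s assume s: "s \<in> S"
    then have "co s = single R s" using SM by (intro uniq) (auto simp: finsupp_single lincomb_single)
    then show "lincomb_of R N g (co s) = g s" using s g by (simp add: N.lincomb_of_single funcset_mem)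
  qed
qed

end

section \<open>Homogeneous bases along the filtration\<close>

context graded_module
begin

text \<open>The two sums are taken in different records; induction on the coefficients reduces the
  comparison to zero, addition and scalar multiplication, which agree.\<close>

lemma lincomb_restrict_graded:
  assumes U: "submodule U R M" and mod: "module R (restrict_graded M U)"
    and c: "c \<in> finsupp R S" and S: "S \<subseteq> U"
  shows "lincomb R (restrict_graded M U) c = lincomb R M c"
proof -
  interpret N: module R "restrict_graded M U" by (rule mod)
  have ops: "carrier (restrict_graded M U) = U" "x \<oplus>\<^bsub>restrict_graded M U\<^esub> y = x \<oplus>\<^bsub>M\<^esub> y"
    "\<zero>\<^bsub>restrict_graded M U\<^esub> = \<zero>\<^bsub>M\<^esub>" "r \<odot>\<^bsub>restrict_graded M U\<^esub> x = r \<odot>\<^bsub>M\<^esub> x" for x y r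
    by (simp_all add: restrict_graded_def)
  have UM: "U \<subseteq> carrier M" using submoduleE(1)[OF U] .
  have g: "(\<lambda>x. x) \<in> S \<rightarrow> carrier M" "(\<lambda>x. x) \<in> S \<rightarrow> carrier (restrict_graded M U)"
    using S UM by (auto simp: ops)
  from c show ?thesis unfolding lincomb_eq_lincomb_of
  proof (induction rule: finsupp_induct)
    case (add c i r)
    then show ?case
      using lincomb_of_step[OF add(1-3) g(1)] N.lincomb_of_step[OF add(1-3) g(2)] by (simp add: ops)
  qed (simp add: lincomb_of_zero N.lincomb_of_zero ops)
qed

lemma free_graded_submodule_basis:
  assumes "free_graded_submodule W R M"
  obtains S where "S \<subseteq> (\<Union>n. grade M n)" "free_on R M S W"
proof -
  have W: "submodule W R M" and f: "free_graded_module R (restrict_graded M W)"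
    using assms by (auto simp: free_graded_submodule_def)
  then obtain S where S: "S \<subseteq> (\<Union>n. grade (restrict_graded M W) n)" "module_basis R (restrict_graded M W) S"
    and mod: "module R (restrict_graded M W)"
    using graded_module.axioms(1) by (auto simp: free_graded_module_def)
  have SW: "S \<subseteq> W" using S(2) by (simp add: module_basis_def restrict_graded_def)
  have "bij_betw (lincomb R M) (finsupp R S) W \<longleftrightarrow>
      bij_betw (lincomb R (restrict_graded M W)) (finsupp R S) W"
    by (rule bij_betw_cong) (simp add: lincomb_restrict_graded[OF W mod _ SW])
  then have "free_on R M S W"
    using S(2) SW submoduleE(1)[OF W] by (simp add: module_basis_def free_on_def restrict_graded_def)
  moreover have "S \<subseteq> (\<Union>n. grade M n)" using S(1) by (auto simp: restrict_graded_def)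
  ultimately show ?thesis using that by blast
qed

lemma free_model_filtration_basis:
  assumes filt: "free_model_filtration R M d U"
  obtains B where "mono B" "B 0 = {}" "\<And>k. B k \<subseteq> (\<Union>n. grade M n)"
    "\<And>k. free_on R M (B k) (U k)" "free_on R M (\<Union>k. B k) (carrier M)"
proof -
  have U0: "U 0 = {\<zero>\<^bsub>M\<^esub>}" and UN: "(\<Union>k. U k) = carrier M"
    and Usub: "\<And>k. submodule (U k) R M"
    using filt by (auto simp: free_model_filtration_def free_graded_submodule_def)
  have "\<forall>k. \<exists>W. free_graded_submodule W R M \<and> U (Suc k) = U k <+>\<^bsub>M\<^esub> W \<and> U k \<inter> W = {\<zero>\<^bsub>M\<^esub>}"
    using filt by (simp add: free_model_filtration_def)
  then obtain W where W: "\<And>k. free_graded_submodule (W k) R M"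
      "\<And>k. U (Suc k) = U k <+>\<^bsub>M\<^esub> W k" "\<And>k. U k \<inter> W k = {\<zero>\<^bsub>M\<^esub>}" by metis
  have "\<forall>k. \<exists>S. S \<subseteq> (\<Union>n. grade M n) \<and> free_on R M S (W k)"
    using free_graded_submodule_basis[OF W(1)] by blast
  then obtain S where S: "\<And>k. S k \<subseteq> (\<Union>n. grade M n)" "\<And>k. free_on R M (S k) (W k)" by metis
  \<comment> \<open>\<open>S j\<close> spans a complement of \<open>U j\<close> in
    \<open>U (Suc j)\<close>. The strict bound \<open>j < k\<close> therefore makes
    \<open>B k\<close> a basis of \<open>U k\<close>, with \<open>B 0\<close> empty for the zero
    module \<open>U 0\<close>.\<close>
  define B where "B k = (\<Union>j<k. S j)" for k
  have BSuc: "B (Suc k) = B k \<union> S k" for k by (auto simp: B_def less_Suc_eq)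
  have free: "free_on R M (B k) (U k)" for k
  proof (induction k)
    case 0
    then show ?case by (simp add: B_def U0 free_on_empty)
  next
    case (Suc k)
    have "submodule (W k) R M" using W(1) by (simp add: free_graded_submodule_def)
    then show ?case unfolding BSuc W(2) by (rule free_on_Un[OF Suc S(2) Usub _ W(3)])
  qed
  have mono: "mono B" unfolding B_def by (intro monoI UN_mono) auto
  show ?thesis
  proof (rule that[OF mono])
    show "free_on R M (\<Union>k. B k) (carrier M)"
      using free_on_UN_chain[OF mono free] by (simp add: UN)
  qed (use S(1) free in \<open>auto simp: B_def\<close>)
qed

end

section \<open>Lifting through a surjective quasi-isomorphism\<close>

lemma graded_algebra_homD:
  assumes "f \<in> graded_algebra_hom R A B"
  shows "f \<in> ring_hom A B" "f \<in> linear_hom R A B" "x \<in> grade A n \<Longrightarrow> f x \<in> grade B n"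
  using assms unfolding graded_algebra_hom_def linear_hom_def ring_hom_def by blast+

lemma dga_homD:
  assumes "f \<in> dga_hom R A dA B dB"
  shows "f \<in> graded_algebra_hom R A B" "x \<in> carrier A \<Longrightarrow> f (dA x) = dB (f x)"
  using assms by (auto simp: dga_hom_def)

context dga
begin

lemma d_linear: "d \<in> linear_hom R A A"
  by (rule linear_homI) (simp_all add: d_closed d_add d_smult)

lemma d_zero: "d \<zero>\<^bsub>A\<^esub> = \<zero>\<^bsub>A\<^esub>"
  by (rule linear_hom_zero[OF module_axioms module_axioms d_linear])

text \<open>The Leibniz rule for \<open>1 \<otimes> 1\<close>, in degree 0 and hence without sign,
  gives d 1 = d 1 + d 1.\<close>

lemma d_one: "d \<one>\<^bsub>A\<^esub> = \<zero>\<^bsub>A\<^esub>"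
proof -
  have "d (\<one>\<^bsub>A\<^esub> \<otimes>\<^bsub>A\<^esub> \<one>\<^bsub>A\<^esub>) = d \<one>\<^bsub>A\<^esub> \<otimes>\<^bsub>A\<^esub> \<one>\<^bsub>A\<^esub> \<oplus>\<^bsub>A\<^esub> neg_pow A 0 (\<one>\<^bsub>A\<^esub> \<otimes>\<^bsub>A\<^esub> d \<one>\<^bsub>A\<^esub>)"
    by (rule d_mult[OF one_grade A.one_closed])
  then have "d \<one>\<^bsub>A\<^esub> = d \<one>\<^bsub>A\<^esub> \<oplus>\<^bsub>A\<^esub> d \<one>\<^bsub>A\<^esub>"
    by (simp add: neg_pow_def d_closed)
  then show ?thesis using d_closed[OF A.one_closed] by (metis M.add.l_cancel_one' )
qed

end

lemma carrier_cohomology: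
  "carrier (cohomology A d) = (\<lambda>x. coboundaries A d +>\<^bsub>A\<^esub> x) ` cocycles A d"
  by (auto simp: cohomology_def graded_quotient_def FactRing_def A_RCOSETS_def' a_r_coset_def' restrict_graded_def)

lemma quasi_isomorphism_lift:
  fixes A :: "('r, 'a, 'x) graded_scheme" and B :: "('r, 'b, 'y) graded_scheme"
  assumes A: "dga R A dA" and B: "dga R B dB"
    and qi: "quasi_isomorphism R A dA B dB \<eta>" and surj: "\<eta> ` carrier A = carrier B"
    and z: "z \<in> grade A (n + 1)" "dA z = \<zero>\<^bsub>A\<^esub>" and b: "b \<in> grade B n" "dB b = \<eta> z"
  shows "\<exists>a\<in>grade A n. \<eta> a = b \<and> dA a = z"
proof -
  interpret A: dga R A dA by fact
  interpret B: dga R B dB by fact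
  have \<eta>: "\<eta> \<in> dga_hom R A dA B dB" and inj: "inj_on (cohomology_map B dB \<eta>) (carrier (cohomology A dA))"
    and onto: "cohomology_map B dB \<eta> ` carrier (cohomology A dA) = carrier (cohomology B dB)"
    using qi by (auto simp: quasi_isomorphism_def bij_betw_def)
  note lin = graded_algebra_homD(2)[OF dga_homD(1)[OF \<eta>]] and deg = graded_algebra_homD(3)[OF dga_homD(1)[OF \<eta>]]
  note comm = dga_homD(2)[OF \<eta>] and hom = linear_homD[OF lin]
  have \<eta>0: "\<eta> \<zero>\<^bsub>A\<^esub> = \<zero>\<^bsub>B\<^esub>" by (rule linear_hom_zero[OF A.module_axioms B.module_axioms lin])
  have zA: "z \<in> carrier A" and bB: "b \<in> carrier B" using z(1) b(1) A.grade_closed B.grade_closed by blast+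
  \<comment> \<open>\<open>mapI\<close> and \<open>mapE\<close> replace the map on classes by
    elements: the image of the class of \<open>x\<close> consists of the sums of
    \<open>dB b'\<close> and \<open>\<eta> (dA a + x)\<close>.\<close>
  have mapI: "dB b' \<oplus>\<^bsub>B\<^esub> \<eta> (dA a \<oplus>\<^bsub>A\<^esub> x) \<in> cohomology_map B dB \<eta> (coboundaries A dA +>\<^bsub>A\<^esub> x)"
    if "b' \<in> carrier B" "a \<in> carrier A" for b' a x
    using that by (auto simp: cohomology_map_def coboundaries_def set_add_def' a_r_coset_def')
  have mapE: "\<exists>b'\<in>carrier B. \<exists>a\<in>carrier A. y = dB b' \<oplus>\<^bsub>B\<^esub> \<eta> (dA a \<oplus>\<^bsub>A\<^esub> x)"
    if "y \<in> cohomology_map B dB \<eta> (coboundaries A dA +>\<^bsub>A\<^esub> x)" for y x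
    using that by (auto simp: cohomology_map_def coboundaries_def set_add_def' a_r_coset_def')
  have trivial: "cohomology_map B dB \<eta> (coboundaries A dA +>\<^bsub>A\<^esub> x) = coboundaries B dB"
    if x: "x \<in> carrier A" and b0: "b0 \<in> carrier B" "\<eta> x = dB b0" for x b0
  proof
    show "cohomology_map B dB \<eta> (coboundaries A dA +>\<^bsub>A\<^esub> x) \<subseteq> coboundaries B dB"
    proof
      fix y assume "y \<in> cohomology_map B dB \<eta> (coboundaries A dA +>\<^bsub>A\<^esub> x)"
      then obtain b' a where ba: "b' \<in> carrier B" "a \<in> carrier A" "y = dB b' \<oplus>\<^bsub>B\<^esub> \<eta> (dA a \<oplus>\<^bsub>A\<^esub> x)"
        using mapE by blast
      have "y = dB (b' \<oplus>\<^bsub>B\<^esub> (\<eta> a \<oplus>\<^bsub>B\<^esub> b0))"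
        using ba x b0 by (simp add: hom A.d_closed comm B.d_add)
      then show "y \<in> coboundaries B dB" using ba b0 hom(1) by (auto simp: coboundaries_def)
    qed
    show "coboundaries B dB \<subseteq> cohomology_map B dB \<eta> (coboundaries A dA +>\<^bsub>A\<^esub> x)"
    proof
      fix y assume "y \<in> coboundaries B dB"
      then obtain b' where b': "b' \<in> carrier B" "y = dB b'" by (auto simp: coboundaries_def)
      have "b' = (b' \<ominus>\<^bsub>B\<^esub> b0) \<oplus>\<^bsub>B\<^esub> b0" using b' b0 by (simp add: a_minus_def B.M.a_assoc B.M.l_neg)
      then have "y = dB (b' \<ominus>\<^bsub>B\<^esub> b0) \<oplus>\<^bsub>B\<^esub> dB b0"
        using b' b0 B.d_add[of "b' \<ominus>\<^bsub>B\<^esub> b0" b0] by simp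
      also have "dB b0 = \<eta> (dA \<zero>\<^bsub>A\<^esub> \<oplus>\<^bsub>A\<^esub> x)" using x b0 by (simp add: A.d_zero)
      finally show "y \<in> cohomology_map B dB \<eta> (coboundaries A dA +>\<^bsub>A\<^esub> x)"
        using mapI[of "b' \<ominus>\<^bsub>B\<^esub> b0" "\<zero>\<^bsub>A\<^esub>" x] b' b0 by simp
    qed
  qed
  \<comment> \<open>Both classes are sent to the zero class, since \<open>\<eta> z\<close> is the
    coboundary of \<open>b\<close> and \<open>\<eta> 0\<close> that of 0; injectivity makes
    \<open>z\<close> a coboundary.\<close>
  have "coboundaries A dA +>\<^bsub>A\<^esub> z = coboundaries A dA +>\<^bsub>A\<^esub> \<zero>\<^bsub>A\<^esub>"
  proof (rule inj_onD[OF inj])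
    show "cohomology_map B dB \<eta> (coboundaries A dA +>\<^bsub>A\<^esub> z) =
        cohomology_map B dB \<eta> (coboundaries A dA +>\<^bsub>A\<^esub> \<zero>\<^bsub>A\<^esub>)"
      using trivial[OF zA bB] trivial[of "\<zero>\<^bsub>A\<^esub>" "\<zero>\<^bsub>B\<^esub>"] b(2) by (simp add: \<eta>0 B.d_zero)
  qed (use zA z(2) A.d_zero in \<open>auto simp: carrier_cohomology cocycles_def\<close>)
  moreover have "dA \<zero>\<^bsub>A\<^esub> \<oplus>\<^bsub>A\<^esub> z \<in> coboundaries A dA +>\<^bsub>A\<^esub> z"
    by (auto simp: a_r_coset_def' coboundaries_def)
  ultimately have "z \<in> coboundaries A dA +>\<^bsub>A\<^esub> \<zero>\<^bsub>A\<^esub>" using zA by (simp add: A.d_zero)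
  then obtain a' where a': "a' \<in> carrier A" "z = dA a'"
    using A.d_closed by (auto simp: a_r_coset_def' coboundaries_def)
  \<comment> \<open>\<open>a'\<close> already has the right differential; \<open>y\<close> measures
    how far it is from lifting \<open>b\<close>. It is a cocycle because \<open>b\<close> and
    \<open>\<eta> a'\<close> have the same differential \<open>\<eta> z\<close>.\<close>
  define y where "y = b \<ominus>\<^bsub>B\<^esub> \<eta> a'"
  have yB: "y \<in> carrier B" using bB a' hom(1) by (simp add: y_def)
  have b_eq: "b = \<eta> a' \<oplus>\<^bsub>B\<^esub> y"
    using bB hom(1)[OF a'(1)] unfolding y_def a_minus_def
    by (metis B.M.a_comm B.M.a_assoc B.M.r_neg B.M.r_zero B.M.a_inv_closed)
  have "dB b = dB (\<eta> a') \<oplus>\<^bsub>B\<^esub> dB y" unfolding b_eq by (rule B.d_add[OF hom(1)[OF a'(1)] yB])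
  moreover have "dB (\<eta> a') = \<eta> z" using comm[OF a'(1)] a'(2) by simp
  ultimately have "\<eta> z = \<eta> z \<oplus>\<^bsub>B\<^esub> dB y" using b(2) by simp
  then have "dB y = \<zero>\<^bsub>B\<^esub>" using hom(1)[OF zA] B.d_closed[OF yB] by (metis B.M.add.l_cancel_one')
  then have "coboundaries B dB +>\<^bsub>B\<^esub> y \<in> carrier (cohomology B dB)"
    using yB by (simp add: carrier_cohomology cocycles_def)
  then obtain x where x: "x \<in> carrier A" "dA x = \<zero>\<^bsub>A\<^esub>"
    and "coboundaries B dB +>\<^bsub>B\<^esub> y = cohomology_map B dB \<eta> (coboundaries A dA +>\<^bsub>A\<^esub> x)"
    unfolding onto[symmetric] by (auto simp: carrier_cohomology cocycles_def)
  moreover have "dB \<zero>\<^bsub>B\<^esub> \<oplus>\<^bsub>B\<^esub> y \<in> coboundaries B dB +>\<^bsub>B\<^esub> y"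
    by (auto simp: a_r_coset_def' coboundaries_def)
  ultimately have "y \<in> cohomology_map B dB \<eta> (coboundaries A dA +>\<^bsub>A\<^esub> x)" using yB by (simp add: B.d_zero)
  then obtain b' a'' where b': "b' \<in> carrier B" and a'': "a'' \<in> carrier A"
    and y: "y = dB b' \<oplus>\<^bsub>B\<^esub> \<eta> (dA a'' \<oplus>\<^bsub>A\<^esub> x)"
    using mapE by blast
  obtain c where c: "c \<in> carrier A" "b' = \<eta> c" using b' surj by blast
  \<comment> \<open>As \<open>c\<close> lifts \<open>b'\<close>, the element \<open>dA c\<close>
    maps to \<open>dB b'\<close>, so the terms added to \<open>a'\<close> map to \<open>y\<close>.
    All of them are cocycles, so the differential remains \<open>z\<close>.\<close>
  define a where "a = a' \<oplus>\<^bsub>A\<^esub> (dA c \<oplus>\<^bsub>A\<^esub> (dA a'' \<oplus>\<^bsub>A\<^esub> x))"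
  have aA: "a \<in> carrier A" using a' a'' c x A.d_closed by (simp add: a_def)
  have "\<eta> a = \<eta> a' \<oplus>\<^bsub>B\<^esub> y" using a' a'' c x A.d_closed by (simp add: a_def y hom comm)
  then have \<eta>a: "\<eta> a = b" using b_eq by simp
  have da: "dA a = z" using a' a'' c x A.d_closed by (simp add: a_def A.d_add A.d_d)
  \<comment> \<open>\<open>a\<close> may be inhomogeneous, but \<open>b\<close> and \<open>z\<close>
    are homogeneous of degrees \<open>n\<close> and \<open>n + 1\<close>, so the component of degree
    \<open>n\<close> still solves both equations.\<close>
  have "\<eta> (component A n a) = component B (n + 0) (\<eta> a)"
    by (rule A.component_linear_hom[OF B.graded_module_axioms lin _ aA, symmetric]) (use deg in simp)
  then have 1: "\<eta> (component A n a) = b" using B.component_homogeneous[OF b(1)] by (simp add: \<eta>a)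
  have "dA (component A n a) = component A (n + 1) (dA a)"
    by (rule A.component_linear_hom[OF A.graded_module_axioms A.d_linear A.d_grade aA, symmetric])
  then have 2: "dA (component A n a) = z" using A.component_homogeneous[OF z(1)] by (simp add: da)
  show ?thesis using 1 2 A.component_decomp(1)[OF aA] by blast
qed

text \<open>The component of degree \<open>n\<close> of any preimage is again a preimage. This
  provides the initial lift, before any condition on differentials.\<close>

lemma surjective_hom_lift_homogeneous:
  assumes A: "graded_module R A" and B: "graded_module R B" and \<eta>: "\<eta> \<in> linear_hom R A B"
    and deg: "\<And>n x. x \<in> grade A n \<Longrightarrow> \<eta> x \<in> grade B n"
    and surj: "\<eta> ` carrier A = carrier B" and b: "b \<in> grade B n"
  shows "\<exists>a\<in>grade A n. \<eta> a = b"
proof -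
  interpret A: graded_module R A by fact
  interpret B: graded_module R B by fact
  have "b \<in> \<eta> ` carrier A" unfolding surj using b by (rule B.grade_closed)
  then obtain a where a: "a \<in> carrier A" "\<eta> a = b" by blast
  have "\<eta> (component A n a) = component B (n + 0) (\<eta> a)"
    by (rule A.component_linear_hom[OF B \<eta> _ a(1), symmetric]) (use deg in simp)
  then have "\<eta> (component A n a) = b" using B.component_homogeneous[OF b] a(2) by simp
  then show ?thesis using A.component_decomp(1)[OF a(1)] by blast
qed

section \<open>Homomorphisms and derivations on the tensor algebra\<close>

context graded_module
begin

text \<open>Commuting with the projections to degree \<open>n\<close> is a linear condition, so it
  can be tested on a basis, and on elements of degree \<open>n\<close> it yields preservation of
  degree. The degree is quantified for each basis element, which avoids choosing a degree
  function.\<close>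

lemma linear_hom_graded_basis:
  assumes N: "graded_module R N" and f: "f \<in> linear_hom R M N" and S: "free_on R M S (carrier M)"
    and deg: "\<And>s. s \<in> S \<Longrightarrow> \<exists>n. s \<in> grade M n \<and> f s \<in> grade N n" and v: "v \<in> grade M n"
  shows "f v \<in> grade N n"
proof -
  interpret N: graded_module R N by fact
  note hom = linear_homD[OF f]
  have f0: "f \<zero>\<^bsub>M\<^esub> = \<zero>\<^bsub>N\<^esub>" by (rule linear_hom_zero[OF module_axioms N.module_axioms f])
  have "component N n (f x) = f (component M n x)" if "x \<in> carrier M" for x
    using S that
  proof (induction rule: free_on_induct)
    case zero
    show ?case using N.component_homogeneous[OF N.grade_zero] component_homogeneous[OF grade_zero]
      by (simp add: f0)
  next
    case (add s r y)
    obtain m where m: "s \<in> grade M m" "f s \<in> grade N m" using deg[OF add(1)] by blast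
    have z: "r \<odot>\<^bsub>M\<^esub> s \<in> grade M m" and fz: "f (r \<odot>\<^bsub>M\<^esub> s) \<in> grade N m"
      using m add(2) hom(3) grade_closed[OF m(1)] submoduleE(4)[OF grade_submodule]
        N.submoduleE(4)[OF N.grade_submodule] by auto
    have "component M n (r \<odot>\<^bsub>M\<^esub> s) \<in> carrier M" "component M n y \<in> carrier M"
      using component_decomp(1) add(3) grade_closed[OF z] grade_closed by blast+
    then show ?case
      using add(3,4) grade_closed[OF z] N.grade_closed[OF fz] hom(1,2)
      by (simp add: component_add N.component_add component_homogeneous[OF z] f0
          N.component_homogeneous[OF fz] del: smult_closed)
  qed
  from this[OF grade_closed[OF v]] have "f v = component N n (f v)"
    using component_homogeneous[OF v] by simp
  also have "\<dots> \<in> grade N n" by (rule N.component_decomp(1)[OF hom(1)[OF grade_closed[OF v]]])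
  finally show ?thesis .
qed

lemma tensor_incl_grade:
  assumes v: "v \<in> grade M n"
  shows "tensor_incl R M v \<in> grade (tensor_algebra R M) n"
proof -
  have "word_degree M n [v]" unfolding word_degree_def by (rule exI[of _ "[n]"]) (use v in simp)
  then have "word R [v] \<in> finsupp R {w \<in> lists (carrier M). word_degree M n w}"
    unfolding word_eq_single by (intro finsupp_single) (use grade_closed[OF v] in simp)
  then show ?thesis by (simp add: tensor_incl_def tensor_algebra_simps)
qed

text \<open>Formulated for linear maps so that it also serves the pair \<open>dA \<circ> F\<close>
  and \<open>F \<circ> d\<close>, which are not multiplicative. Agreement at \<open>y\<close> passes
  to \<open>s y\<close> for basis elements \<open>s\<close>, by linearity to \<open>v y\<close> for
  \<open>v\<close> in \<open>U\<close>, from there to words built up from the empty one, and finally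
  to their span.\<close>

lemma tensor_sub_eqI:
  assumes T: "graded_algebra R (tensor_algebra R M)" and N: "module R N"
    and h: "h \<in> linear_hom R (tensor_algebra R M) N" and h': "h' \<in> linear_hom R (tensor_algebra R M) N"
    and S: "free_on R M S U" and U: "U \<subseteq> carrier M"
    and one: "h \<one>\<^bsub>tensor_algebra R M\<^esub> = h' \<one>\<^bsub>tensor_algebra R M\<^esub>"
    and mult: "\<And>s y. \<lbrakk>s \<in> S; y \<in> carrier (tensor_algebra R M); h y = h' y\<rbrakk> \<Longrightarrow>
      h (tensor_incl R M s \<otimes>\<^bsub>tensor_algebra R M\<^esub> y) = h' (tensor_incl R M s \<otimes>\<^bsub>tensor_algebra R M\<^esub> y)"
    and x: "x \<in> tensor_sub R M U"
  shows "h x = h' x"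
proof -
  interpret T: graded_algebra R "tensor_algebra R M" by fact
  interpret N: module R N by fact
  note hom = linear_homD[OF h] linear_homD[OF h'] and incl = linear_homD[OF tensor_incl_linear]
  have h0: "h \<zero>\<^bsub>tensor_algebra R M\<^esub> = \<zero>\<^bsub>N\<^esub>" "h' \<zero>\<^bsub>tensor_algebra R M\<^esub> = \<zero>\<^bsub>N\<^esub>"
    using linear_hom_zero[OF T.module_axioms N.module_axioms] h h' by blast+
  have incl0: "tensor_incl R M \<zero>\<^bsub>M\<^esub> = \<zero>\<^bsub>tensor_algebra R M\<^esub>"
    by (rule linear_hom_zero[OF module_axioms T.module_axioms tensor_incl_linear])
  have SM: "S \<subseteq> carrier M" using S by (simp add: free_on_def)
  have mult': "h (tensor_incl R M v \<otimes>\<^bsub>tensor_algebra R M\<^esub> y) = h' (tensor_incl R M v \<otimes>\<^bsub>tensor_algebra R M\<^esub> y)"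
    if v: "v \<in> U" and y: "y \<in> carrier (tensor_algebra R M)" "h y = h' y" for v y
    using S v
  proof (induction rule: free_on_induct)
    case zero
    then show ?case using y by (simp add: incl0 h0)
  next
    case (add s r u)
    have s: "s \<in> carrier M" using add(1) SM by blast
    note cl = incl(1)[OF s] incl(1)[OF add(3)]
    have "tensor_incl R M (r \<odot>\<^bsub>M\<^esub> s \<oplus>\<^bsub>M\<^esub> u) \<otimes>\<^bsub>tensor_algebra R M\<^esub> y =
        r \<odot>\<^bsub>tensor_algebra R M\<^esub> (tensor_incl R M s \<otimes>\<^bsub>tensor_algebra R M\<^esub> y) \<oplus>\<^bsub>tensor_algebra R M\<^esub>
        tensor_incl R M u \<otimes>\<^bsub>tensor_algebra R M\<^esub> y"
      using s add(2,3) cl y(1) by (simp add: incl(2,3) T.A.l_distr T.smult_mult_left)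
    then show ?case
      using cl y(1) add(2,4) mult[OF add(1) y] by (simp add: hom(2,3,5,6))
  qed
  have word: "tensor_class R M (word R w) \<in> carrier (tensor_algebra R M)" if "w \<in> lists (carrier M)" for w
    using that by (simp add: tensor_algebra_simps word_eq_single finsupp_single)
  have eq_word: "h (tensor_class R M (word R w)) = h' (tensor_class R M (word R w))" if "w \<in> lists U" for w
    using that
  proof (induction w)
    case Nil
    then show ?case using one by (simp add: tensor_algebra_simps)
  next
    case (Cons v w)
    have "v \<in> carrier M" "w \<in> lists (carrier M)" using Cons(1,2) U by auto
    then show ?case
      using mult'[OF Cons(1) word Cons(3)] by (simp add: tensor_class_word_Cons)
  qed
  show ?thesis
    using x unfolding tensor_sub_def
  proof (induction rule: tensor_span_induct)
    case zero
    then show ?case by (simp add: h0)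
  next
    case (add x w r)
    have "w \<in> lists U" using add(3) by auto
    then show ?case using add word[OF add(2)] eq_word by (simp add: hom(2,3,5,6))
  qed
qed

lemma tensor_hom_eqI:
  assumes T: "graded_algebra R (tensor_algebra R M)" and N: "graded_algebra R N"
    and h: "h \<in> graded_algebra_hom R (tensor_algebra R M) N"
    and h': "h' \<in> graded_algebra_hom R (tensor_algebra R M) N"
    and S: "free_on R M S U" and U: "U \<subseteq> carrier M"
    and eq: "\<And>s. s \<in> S \<Longrightarrow> h (tensor_incl R M s) = h' (tensor_incl R M s)"
    and x: "x \<in> tensor_sub R M U"
  shows "h x = h' x"
proof (rule tensor_sub_eqI[OF T _ _ _ S U _ _ x])
  note hD = graded_algebra_homD[OF h] graded_algebra_homD[OF h']
  show "module R N" using N by (simp add: graded_algebra_def graded_module_def)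
  show "h \<in> linear_hom R (tensor_algebra R M) N" "h' \<in> linear_hom R (tensor_algebra R M) N"
    using hD by blast+
  show "h \<one>\<^bsub>tensor_algebra R M\<^esub> = h' \<one>\<^bsub>tensor_algebra R M\<^esub>"
    using ring_hom_one hD(1,4) by metis
  fix s y assume sy: "s \<in> S" "y \<in> carrier (tensor_algebra R M)" "h y = h' y"
  then have "s \<in> carrier M" using S by (auto simp: free_on_def)
  then have "tensor_incl R M s \<in> carrier (tensor_algebra R M)" by (rule linear_homD(1)[OF tensor_incl_linear])
  then show "h (tensor_incl R M s \<otimes>\<^bsub>tensor_algebra R M\<^esub> y) = h' (tensor_incl R M s \<otimes>\<^bsub>tensor_algebra R M\<^esub> y)"
    using sy eq by (simp add: ring_hom_mult[OF hD(1)] ring_hom_mult[OF hD(4)])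
qed

text \<open>With \<open>F\<close> the lift of \<open>f\<close>, both composites are derivations
  along \<open>F\<close>: D(s y) is D(s) F(y) plus or minus F(s) D(y). The signs coincide because
  \<open>f\<close> preserves degrees, so agreement at \<open>s\<close> and at \<open>y\<close> gives
  agreement at their product.\<close>

lemma tensor_lift_commute:
  assumes A: "dga R A dA" and T: "dga R (tensor_algebra R M) d"
    and f: "f \<in> linear_hom R M A" and deg: "\<And>n v. v \<in> grade M n \<Longrightarrow> f v \<in> grade A n"
    and S: "free_on R M S U" and U: "U \<subseteq> carrier M" and hom: "S \<subseteq> (\<Union>n. grade M n)"
    and eq: "\<And>s. s \<in> S \<Longrightarrow> dA (f s) = tensor_lift R A f (d (tensor_incl R M s))"
    and x: "x \<in> tensor_sub R M U"
  shows "dA (tensor_lift R A f x) = tensor_lift R A f (d x)"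
proof (rule tensor_sub_eqI[OF _ _ _ _ S U _ _ x])
  interpret A: dga R A dA by fact
  interpret T: dga R "tensor_algebra R M" d by fact
  show "graded_algebra R (tensor_algebra R M)" by (rule T.graded_algebra_axioms)
  show "module R A" by (rule A.module_axioms)
  note lin = tensor_lift_linear[OF A.graded_algebra_axioms f] and rh = tensor_lift_ring_hom[OF A.graded_algebra_axioms f]
  note F = linear_homD[OF lin]
  show "(\<lambda>x. dA (tensor_lift R A f x)) \<in> linear_hom R (tensor_algebra R M) A"
    by (rule linear_hom_comp[OF lin A.d_linear])
  show "(\<lambda>x. tensor_lift R A f (d x)) \<in> linear_hom R (tensor_algebra R M) A"
    by (rule linear_hom_comp[OF T.d_linear lin])
  have F0: "tensor_lift R A f \<zero>\<^bsub>tensor_algebra R M\<^esub> = \<zero>\<^bsub>A\<^esub>"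
    by (rule linear_hom_zero[OF T.module_axioms A.module_axioms lin])
  show "dA (tensor_lift R A f \<one>\<^bsub>tensor_algebra R M\<^esub>) = tensor_lift R A f (d \<one>\<^bsub>tensor_algebra R M\<^esub>)"
    by (simp add: ring_hom_one[OF rh] A.d_one T.d_one F0)
  \<comment> \<open>Negation is multiplication by the scalar -1, so the Leibniz sign passes through
    \<open>F\<close> by linearity.\<close>
  have F_neg: "tensor_lift R A f (neg_pow (tensor_algebra R M) n y) = neg_pow A n (tensor_lift R A f y)"
    if y: "y \<in> carrier (tensor_algebra R M)" for n y
  proof -
    have "\<ominus>\<^bsub>tensor_algebra R M\<^esub> y = (\<ominus> \<one>) \<odot>\<^bsub>tensor_algebra R M\<^esub> y"
      using y by (simp add: T.smult_l_minus)
    then show ?thesis using y F(1)[OF y] by (simp add: neg_pow_def F(3) A.smult_l_minus)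
  qed
  fix s y assume s: "s \<in> S" and y: "y \<in> carrier (tensor_algebra R M)"
    and eqy: "dA (tensor_lift R A f y) = tensor_lift R A f (d y)"
  obtain n where n: "s \<in> grade M n" using hom s by blast
  have sM: "s \<in> carrier M" using n by (rule grade_closed)
  have si: "tensor_incl R M s \<in> carrier (tensor_algebra R M)" by (rule linear_homD(1)[OF tensor_incl_linear sM])
  note Fi = tensor_lift_incl[OF A.graded_algebra_axioms f sM]
  have "dA (tensor_lift R A f (tensor_incl R M s \<otimes>\<^bsub>tensor_algebra R M\<^esub> y)) = dA (f s \<otimes>\<^bsub>A\<^esub> tensor_lift R A f y)"
    by (simp add: ring_hom_mult[OF rh si y] Fi)
  also have "\<dots> = dA (f s) \<otimes>\<^bsub>A\<^esub> tensor_lift R A f y \<oplus>\<^bsub>A\<^esub> neg_pow A n (f s \<otimes>\<^bsub>A\<^esub> tensor_lift R A f (d y))"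
    by (simp add: A.d_mult[OF deg[OF n] F(1)[OF y]] eqy)
  also have "\<dots> = tensor_lift R A f (d (tensor_incl R M s) \<otimes>\<^bsub>tensor_algebra R M\<^esub> y \<oplus>\<^bsub>tensor_algebra R M\<^esub>
      neg_pow (tensor_algebra R M) n (tensor_incl R M s \<otimes>\<^bsub>tensor_algebra R M\<^esub> d y))"
    using si y T.d_closed by (simp add: F(2) neg_pow_def[of "tensor_algebra R M"] F_neg[unfolded neg_pow_def[of "tensor_algebra R M"]] ring_hom_mult[OF rh] Fi eq[OF s])
  also have "\<dots> = tensor_lift R A f (d (tensor_incl R M s \<otimes>\<^bsub>tensor_algebra R M\<^esub> y))"
    by (simp add: T.d_mult[OF tensor_incl_grade[OF n] y])
  finally show "dA (tensor_lift R A f (tensor_incl R M s \<otimes>\<^bsub>tensor_algebra R M\<^esub> y)) =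
      tensor_lift R A f (d (tensor_incl R M s \<otimes>\<^bsub>tensor_algebra R M\<^esub> y))" .
qed

end


section \<open>Construction of the lift along the filtration\<close>

theorem proposition3p2:
  fixes R :: "('r, 'k) ring_scheme"
    and A :: "('r, 'a) graded" and B :: "('r, 'b) graded" and V :: "('r, 'v) graded"
  assumes "principal_domain R"
    and "dga R A dA" and "dga R B dB" and "dga R (tensor_algebra R V) d"
    and "\<eta> \<in> dga_hom R A dA B dB"
    and "\<psi> \<in> dga_hom R (tensor_algebra R V) d B dB"
    and "minimal_dga R V d"
    and "\<eta> ` carrier A = carrier B" and "quasi_isomorphism R A dA B dB \<eta>"
  shows "\<exists>\<phi>\<in>dga_hom R (tensor_algebra R V) d A dA.
           \<forall>x\<in>carrier (tensor_algebra R V). \<eta> (\<phi> x) = \<psi> x"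
proof -
  interpret A: dga R A dA by fact
  interpret B: dga R B dB by fact
  interpret T: dga R "tensor_algebra R V" d by fact
  have "graded_module R V" using assms(7) by (simp add: minimal_dga_def free_graded_module_def)
  then interpret V: graded_module R V .
  obtain U where filt: "free_model_filtration R V d U" using assms(7) by (auto simp: minimal_dga_def)
  have d_U: "d (tensor_incl R V v) \<in> tensor_sub R V (U k)" if "v \<in> U (Suc k)" for v k
    using filt that by (simp add: free_model_filtration_def)
  have U_carrier: "U k \<subseteq> carrier V" for k using filt by (auto simp: free_model_filtration_def)
  obtain S where "mono S" and S0: "S 0 = {}" and S_hom: "\<And>k. S k \<subseteq> (\<Union>n. grade V n)"
    and S_free: "\<And>k. free_on R V (S k) (U k)" and S_basis: "free_on R V (\<Union>k. S k) (carrier V)"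
    using V.free_model_filtration_basis[OF filt] by blast
  have S_mono: "S k \<subseteq> S l" if "k \<le> l" for k l using \<open>mono S\<close> that by (rule monoD)
  have S_U: "S k \<subseteq> U k" for k
  proof
    fix s assume s: "s \<in> S k"
    then have "s \<in> carrier V" using S_free[of k] by (auto simp: free_on_def)
    then have "s = lincomb R V (single R s)" by (simp add: V.lincomb_single)
    also have "\<dots> \<in> U k"
      using S_free[of k] A.finsupp_single[OF s] by (auto simp: free_on_def bij_betw_def)
    finally show "s \<in> U k" .
  qed
  have S_carrier: "s \<in> carrier V" if "s \<in> S k" for s k using S_U U_carrier that by blast
  have d_S: "d (tensor_incl R V s) \<in> tensor_sub R V (U k)" if "s \<in> S (Suc k)" for s k
    using d_U S_U that by blast
  note eta = dga_homD[OF assms(5)] and psi = dga_homD[OF assms(6)]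
  note etaD = graded_algebra_homD[OF eta(1)] and psiD = graded_algebra_homD[OF psi(1)]
  let ?F = "tensor_lift R A" and ?\<iota> = "tensor_incl R V"
  note incl = linear_homD(1)[OF V.tensor_incl_linear]

  \<comment> \<open>Only values on the basis are constrained; \<open>liftsD\<close> propagates the
    degree condition to all of \<open>V\<close> and the lifting equation to all of
    \<open>T V\<close>.\<close>
  define lifts where "lifts f \<longleftrightarrow> f \<in> linear_hom R V A \<and>
    (\<forall>s\<in>\<Union>k. S k. (\<exists>n. s \<in> grade V n \<and> f s \<in> grade A n) \<and> \<eta> (f s) = \<psi> (?\<iota> s))" for f
  define stage where "stage k f \<longleftrightarrow> lifts f \<and> (\<forall>s\<in>S k. dA (f s) = ?F f (d (?\<iota> s)))" for k f

  have liftsD: "f \<in> linear_hom R V A" "\<And>n v. v \<in> grade V n \<Longrightarrow> f v \<in> grade A n"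
    "?F f \<in> graded_algebra_hom R (tensor_algebra R V) A"
    "\<And>x. x \<in> carrier (tensor_algebra R V) \<Longrightarrow> \<eta> (?F f x) = \<psi> x" if f: "lifts f" for f
  proof -
    show lin: "f \<in> linear_hom R V A" using f by (simp add: lifts_def)
    show deg: "\<And>n v. v \<in> grade V n \<Longrightarrow> f v \<in> grade A n"
      by (rule V.linear_hom_graded_basis[OF A.graded_module_axioms lin S_basis])
         (use f in \<open>auto simp: lifts_def\<close>)
    show hom: "?F f \<in> graded_algebra_hom R (tensor_algebra R V) A"
      by (rule V.tensor_lift_graded[OF A.graded_algebra_axioms lin deg])
    note FD = graded_algebra_homD[OF hom]
    have comp: "(\<lambda>x. \<eta> (?F f x)) \<in> graded_algebra_hom R (tensor_algebra R V) B"
      using ring_hom_trans[OF FD(1) etaD(1)] linear_homD(3)[OF linear_hom_comp[OF FD(2) etaD(2)]]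
        FD(3) etaD(3) by (auto simp: graded_algebra_hom_def comp_def)
    fix x assume x: "x \<in> carrier (tensor_algebra R V)"
    show "\<eta> (?F f x) = \<psi> x"
    proof (rule V.tensor_hom_eqI[OF T.graded_algebra_axioms B.graded_algebra_axioms comp psi(1) S_basis])
      fix s assume s: "s \<in> (\<Union>k. S k)"
      then have "s \<in> carrier V" using S_carrier by blast
      moreover have "\<eta> (f s) = \<psi> (?\<iota> s)" using f s unfolding lifts_def by blast
      ultimately show "\<eta> (?F f (?\<iota> s)) = \<psi> (?\<iota> s)"
        by (simp add: V.tensor_lift_incl[OF A.graded_algebra_axioms lin])
    qed (use x in \<open>simp_all add: V.tensor_sub_carrier\<close>)
  qed

  have F_cong: "?F f x = ?F f' x"
    if "lifts f" "lifts f'" "\<And>s. s \<in> S k \<Longrightarrow> f s = f' s" "x \<in> tensor_sub R V (U k)" for f f' k x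
  proof (rule V.tensor_hom_eqI[OF T.graded_algebra_axioms A.graded_algebra_axioms
        liftsD(3)[OF that(1)] liftsD(3)[OF that(2)] S_free U_carrier _ that(4)])
    fix s assume "s \<in> S k"
    then show "?F f (?\<iota> s) = ?F f' (?\<iota> s)"
      using that(3) S_carrier V.tensor_lift_incl[OF A.graded_algebra_axioms liftsD(1)[OF that(1)]]
        V.tensor_lift_incl[OF A.graded_algebra_axioms liftsD(1)[OF that(2)]] by simp
  qed

  \<comment> \<open>\<open>Q\<close> and \<open>N\<close> stay general because there are two uses:
    \<open>S k\<close> with \<open>U k\<close> in the inductive step, and the whole basis with
    \<open>carrier V\<close> at the end.\<close>
  have F_comm: "dA (?F f x) = ?F f (d x)"
    if "lifts f" "\<And>s. s \<in> Q \<Longrightarrow> dA (f s) = ?F f (d (?\<iota> s))" "free_on R V Q N" "Q \<subseteq> (\<Union>k. S k)"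
      "N \<subseteq> carrier V" "x \<in> tensor_sub R V N" for f Q N x
    by (rule V.tensor_lift_commute[OF assms(2,4) liftsD(1,2)[OF that(1)] that(3,5) _ that(2,6)])
       (use that(4) S_hom in blast)+

  have extend: "\<exists>f. lifts f \<and> (\<forall>s\<in>\<Union>k. S k. f s = g s)"
    if g: "\<And>s. s \<in> (\<Union>k. S k) \<Longrightarrow> (\<exists>n. s \<in> grade V n \<and> g s \<in> grade A n) \<and> \<eta> (g s) = \<psi> (?\<iota> s)" for g
  proof -
    have "g \<in> (\<Union>k. S k) \<rightarrow> carrier A" using g A.grade_closed by blast
    then obtain f where f: "f \<in> linear_hom R V A" "\<forall>s\<in>\<Union>k. S k. f s = g s"
      using V.free_on_extend[OF S_basis A.module_axioms] by blast
    have "(\<exists>n. s \<in> grade V n \<and> f s \<in> grade A n) \<and> \<eta> (f s) = \<psi> (?\<iota> s)" if "s \<in> (\<Union>k. S k)" for s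
      using g[OF that] bspec[OF f(2) that] by simp
    then show ?thesis using f unfolding lifts_def by blast
  qed

  \<comment> \<open>\<open>S 0\<close> is empty, so the condition on differentials is vacuous and
    surjectivity of \<eta> in each degree suffices.\<close>
  have "\<exists>f. stage 0 f"
  proof -
    have "\<exists>a. (\<exists>n. s \<in> grade V n \<and> a \<in> grade A n) \<and> \<eta> a = \<psi> (?\<iota> s)" if s: "s \<in> (\<Union>k. S k)" for s
    proof -
      obtain n where n: "s \<in> grade V n" using s S_hom by blast
      then have "\<psi> (?\<iota> s) \<in> grade B n" by (intro psiD(3) V.tensor_incl_grade)
      then have "\<exists>a\<in>grade A n. \<eta> a = \<psi> (?\<iota> s)"
        by (intro surjective_hom_lift_homogeneous[OF A.graded_module_axioms B.graded_module_axioms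
              etaD(2,3) assms(8)])
      then show ?thesis using n by blast
    qed
    then obtain g where "\<And>s. s \<in> (\<Union>k. S k) \<Longrightarrow> (\<exists>n. s \<in> grade V n \<and> g s \<in> grade A n) \<and> \<eta> (g s) = \<psi> (?\<iota> s)"
      by metis
    then obtain f where "lifts f" using extend[of g] by blast
    then show ?thesis by (auto simp: stage_def S0)
  qed

  moreover have "\<exists>f'. stage (Suc k) f' \<and> (\<forall>s\<in>S k. f' s = f s)" if f: "stage k f" for k f
  proof -
    have lf: "lifts f" and eq: "\<And>s. s \<in> S k \<Longrightarrow> dA (f s) = ?F f (d (?\<iota> s))"
      using f by (auto simp: stage_def)
    have "\<exists>a. (\<exists>n. s \<in> grade V n \<and> a \<in> grade A n) \<and> \<eta> a = \<psi> (?\<iota> s) \<and>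
        (s \<in> S k \<longrightarrow> a = f s) \<and> (s \<in> S (Suc k) \<longrightarrow> dA a = ?F f (d (?\<iota> s)))" if s: "s \<in> (\<Union>k. S k)" for s
    \<comment> \<open>Only the elements that are new in \<open>S (Suc k)\<close> receive new values.
      All others, including those of later stages, keep the value of \<open>f\<close>, which already
      lifts \<psi>.\<close>
    proof (cases "s \<in> S (Suc k) \<and> s \<notin> S k")
      case False
      then have "s \<in> S (Suc k) \<longrightarrow> dA (f s) = ?F f (d (?\<iota> s))" using eq by blast
      then show ?thesis using lf s unfolding lifts_def by (intro exI[of _ "f s"]) blast
    next
      case True
      obtain n where n: "s \<in> grade V n" using s S_hom by blast
      have ig: "?\<iota> s \<in> grade (tensor_algebra R V) n" using n by (rule V.tensor_incl_grade)
      then have ic: "?\<iota> s \<in> carrier (tensor_algebra R V)" by (rule T.grade_closed)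
      have dc: "d (?\<iota> s) \<in> carrier (tensor_algebra R V)" using ic by (rule T.d_closed)
      have z: "?F f (d (?\<iota> s)) \<in> grade A (n + 1)"
        by (intro graded_algebra_homD(3)[OF liftsD(3)[OF lf]] T.d_grade ig)
      have "dA (?F f (d (?\<iota> s))) = ?F f (d (d (?\<iota> s)))"
        by (rule F_comm[OF lf eq S_free _ U_carrier d_S]) (use True in auto)
      also have "\<dots> = \<zero>\<^bsub>A\<^esub>"
        using linear_hom_zero[OF T.module_axioms A.module_axioms graded_algebra_homD(2)[OF liftsD(3)[OF lf]]]
        by (simp add: T.d_d[OF ic])
      finally have dz: "dA (?F f (d (?\<iota> s))) = \<zero>\<^bsub>A\<^esub>" .
      have "dB (\<psi> (?\<iota> s)) = \<eta> (?F f (d (?\<iota> s)))"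
        by (simp add: liftsD(4)[OF lf dc] psi(2)[OF ic])
      then obtain a where "a \<in> grade A n" "\<eta> a = \<psi> (?\<iota> s)" "dA a = ?F f (d (?\<iota> s))"
        using quasi_isomorphism_lift[OF assms(2,3,9,8) z dz psiD(3)[OF ig]] by blast
      then show ?thesis using n True by blast
    qed
    then obtain g where g: "\<And>s. s \<in> (\<Union>k. S k) \<Longrightarrow> (\<exists>n. s \<in> grade V n \<and> g s \<in> grade A n) \<and> \<eta> (g s) = \<psi> (?\<iota> s) \<and>
        (s \<in> S k \<longrightarrow> g s = f s) \<and> (s \<in> S (Suc k) \<longrightarrow> dA (g s) = ?F f (d (?\<iota> s)))" by metis
    then obtain f' where lf': "lifts f'" and f'g: "\<And>s. s \<in> (\<Union>k. S k) \<Longrightarrow> f' s = g s"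
      using extend[of g] by blast
    have f'f: "f' s = f s" if s: "s \<in> S k" for s
    proof -
      have sS: "s \<in> (\<Union>k. S k)" using s by blast
      show ?thesis using g[OF sS] f'g[OF sS] s by simp
    qed
    have "dA (f' s) = ?F f' (d (?\<iota> s))" if s: "s \<in> S (Suc k)" for s
    proof -
      have sS: "s \<in> (\<Union>k. S k)" using s by blast
      have "dA (f' s) = ?F f (d (?\<iota> s))" using g[OF sS] f'g[OF sS] s by simp
      \<comment> \<open>The values were matched against the extension of the old map, while the new
        stage asks for that of the new map; both agree on \<open>T (U k)\<close>, which contains the
        differential of \<open>s\<close>.\<close>
      also have "\<dots> = ?F f' (d (?\<iota> s))" by (rule F_cong[OF lf lf' f'f[symmetric] d_S[OF s]])
      finally show ?thesis .
    qed
    then show ?thesis using lf' f'f by (auto simp: stage_def)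
  qed

  \<comment> \<open>Dependent choice retains agreement on \<open>S k\<close>, so the sequence of
    values at each basis element is eventually constant.\<close>
  ultimately obtain fs where "\<forall>k. stage k (fs k) \<and> (\<forall>s\<in>S k. fs (Suc k) s = fs k s)"
    using dependent_nat_choice[of stage "\<lambda>k f f'. \<forall>s\<in>S k. f' s = f s"] by blast
  then have fs: "\<And>k. stage k (fs k)" and fs_Suc: "\<And>k s. s \<in> S k \<Longrightarrow> fs (Suc k) s = fs k s" by blast+
  have fs_le: "fs l s = fs k s" if "k \<le> l" "s \<in> S k" for k l s
    using that(1)
  proof (induction l rule: dec_induct)
    case (step l)
    then show ?case using fs_Suc[of s l] S_mono[of k l] that(2) by auto
  qed simp
  \<comment> \<open>The least stage containing \<open>s\<close> serves as a canonical index; by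
    \<open>fs_le\<close> every later stage gives the same value.\<close>
  define g where "g s = fs (LEAST k. s \<in> S k) s" for s
  have g: "fs k s = g s" if "s \<in> S k" for k s
    unfolding g_def using that
    by (intro fs_le Least_le[of "\<lambda>k. s \<in> S k"] LeastI[of "\<lambda>k. s \<in> S k"])
  have lfs: "lifts (fs k)" for k using fs by (simp add: stage_def)
  have "(\<exists>n. s \<in> grade V n \<and> g s \<in> grade A n) \<and> \<eta> (g s) = \<psi> (?\<iota> s)" if s: "s \<in> (\<Union>k. S k)" for s
  proof -
    obtain k where k: "s \<in> S k" using s by blast
    have "(\<exists>n. s \<in> grade V n \<and> fs k s \<in> grade A n) \<and> \<eta> (fs k s) = \<psi> (?\<iota> s)"
      using lfs[of k] s unfolding lifts_def by blast
    then show ?thesis by (simp add: g[OF k])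
  qed
  then obtain f where lf: "lifts f" and fg: "\<And>s. s \<in> (\<Union>k. S k) \<Longrightarrow> f s = g s" using extend[of g] by blast
  have f: "f s = fs k s" if s: "s \<in> S k" for k s
  proof -
    have "s \<in> (\<Union>k. S k)" using s by blast
    then show ?thesis by (simp add: fg g[OF s] del: UN_iff)
  qed
  have comm: "dA (f s) = ?F f (d (?\<iota> s))" if s: "s \<in> (\<Union>k. S k)" for s
  proof -
    obtain k where "s \<in> S k" using s by blast
    \<comment> \<open>The index is raised by one because \<open>d_S\<close> locates differentials in
      \<open>T (U k)\<close> for elements of \<open>S (Suc k)\<close>; this also spares a separate
      treatment of \<open>k = 0\<close>.\<close>
    then have sk: "s \<in> S (Suc k)" using S_mono[of k "Suc k"] by auto
    have "dA (f s) = dA (fs (Suc k) s)" by (simp add: f[OF sk])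
    also have "\<dots> = ?F (fs (Suc k)) (d (?\<iota> s))" using fs[of "Suc k"] sk by (simp add: stage_def)
    also have "\<dots> = ?F f (d (?\<iota> s))"
    proof (rule F_cong[OF lfs lf _ d_S[OF sk]])
      fix t assume "t \<in> S k"
      then have "t \<in> S (Suc k)" using S_mono[of k "Suc k"] by auto
      then show "fs (Suc k) t = f t" by (simp add: f)
    qed
    finally show ?thesis .
  qed
  have "?F f \<in> dga_hom R (tensor_algebra R V) d A dA"
    using liftsD(3)[OF lf] F_comm[OF lf comm S_basis subset_refl subset_refl]
    by (simp add: dga_hom_def V.tensor_sub_carrier)
  then show ?thesis using liftsD(4)[OF lf] by blast
qed

end
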